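(* Let $p>2$ and let $(W_k)_{k\ge0}$ be the Markov chain described in the context with $p_k=1/(\zeta(p+1)k^{p+1})$, $k\in\mathbb{N}^*$, where $\zeta(p+1)=\sum_{k\ge1}k^{-(p+1)}$. Then $$\sum_{n\ge1}n^{p-2}\,\mathbb{P}_{\nu\otimes\nu}(T^*\ge n)=\infty,$$ and for any $\varepsilon>0$, $$\sum_{n\ge2}n^{p-2}(\log n)^{-(1+\varepsilon)}\,\mathbb{P}_{\nu\otimes\nu}(T^*\ge n)<\infty.$$ Moreover, for any stationary and Gaussian centered sequence $(g_k)_{k\in\mathbb{Z}}$ with convergent series of covariances, $$\limsup_{n\to\infty}\,(n\log n)^{-1/p}\Big|\sum_{k=1}^n(\mathbf{1}_{\{W_k=0\}}-\nu_0)-\sum_{k=1}^ng_k\Big|>0\quad\text{almost surely.}$$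
   Context: Let $(\varepsilon_i)_{i\in\mathbb{Z}}$ be iid with $\mathbb{P}(\varepsilon_i=k)=p_k$, $k\in\mathbb{N}^*=\{1,2,\dots\}$. Let $W_0$ be an $\mathbb{N}$-valued random variable ($\mathbb{N}=\{0,1,2,\dots\}$) independent of $(\varepsilon_i)_{i\in\mathbb Z}$, and for $k\ge1$ $$W_k=(W_{k-1}-1)\mathbf{1}_{W_{k-1}\ne0}+(\varepsilon_k-1)\mathbf{1}_{W_{k-1}=0}.$$ This is a Markov chain on $\mathbb{N}$ with transitions $P_{i,i-1}=1$, $P_{0,i-1}=p_i$ ($i\ge1$). When $\mathbb{E}(\varepsilon_1)<\infty$, its stationary distribution $\nu=(\nu_j)_{j\ge0}$ is $\nu_0=1/\mathbb{E}(\varepsilon_1)$, $\nu_j=\nu_0\sum_{i\ge j+1}p_i$ for $j\ge1$. Let $(W_k^* )_{k\ge0}$ be defined by the same recursion with the same $(\varepsilon_k)$, started from $W_0^*$, and let $T^*=\inf\{k\in\mathbb{N}:W_k=W_k^*\}$. $\mathbb{P}_{\nu\otimes\nu}$ means that $W_0$ and $W_0^*$ both have law $\nu$ and $W_0,W_0^*,(\varepsilon_i)$ are independent. The Gaussian sequence $(g_k)$ is any such sequence defined on the same probability space as $(W_k)$ (with arbitrary joint law). *)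

theory Defs
  imports "HOL-Probability.Probability"
begin

definition zeta_weight :: "real \<Rightarrow> nat \<Rightarrow> real" where
  "zeta_weight p k = 1 / ((\<Sum>i. real (Suc i) powr - (p + 1)) * real k powr (p + 1))"

(* The innovations take values in {1, 2, ...} almost surely, so truncated subtraction on nat
   changes the second summand only on a null set. *)
primrec chain :: "('a \<Rightarrow> nat) \<Rightarrow> (int \<Rightarrow> 'a \<Rightarrow> nat) \<Rightarrow> nat \<Rightarrow> 'a \<Rightarrow> nat" where
  "chain V eps 0 \<omega> = V \<omega>"
| "chain V eps (Suc k) \<omega> =
     (chain V eps k \<omega> - 1) * of_bool (chain V eps k \<omega> \<noteq> 0) +
     (eps (int (Suc k)) \<omega> - 1) * of_bool (chain V eps k \<omega> = 0)"

(* X has the common law of the innovations: nu_0 = 1 / E X and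
   nu_j = nu_0 * (sum over i >= j + 1 of P (X = i)) for j >= 1. *)
definition stationary_weight :: "'a measure \<Rightarrow> ('a \<Rightarrow> nat) \<Rightarrow> nat \<Rightarrow> real" where
  "stationary_weight M X j =
     1 / (\<integral>\<omega>. real (X \<omega>) \<partial>M) *
     (if j = 0 then 1 else (\<Sum>i. measure M {\<omega> \<in> space M. X \<omega> = j + 1 + i}))"

(* The infimum of the empty set is infinity. *)
definition meeting_time :: "(nat \<Rightarrow> 'a \<Rightarrow> nat) \<Rightarrow> (nat \<Rightarrow> 'a \<Rightarrow> nat) \<Rightarrow> 'a \<Rightarrow> enat" where
  "meeting_time W W' \<omega> = (INF k\<in>{k. W k \<omega> = W' k \<omega>}. enat k)"

definition iid_innovations :: "'a measure \<Rightarrow> (int \<Rightarrow> 'a \<Rightarrow> nat) \<Rightarrow> (nat \<Rightarrow> real) \<Rightarrow> bool" where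
  "iid_innovations M eps q \<longleftrightarrow>
     prob_space.indep_vars M (\<lambda>_. count_space UNIV) eps UNIV \<and>
     (\<forall>i. \<forall>k\<ge>1. measure M {\<omega> \<in> space M. eps i \<omega> = k} = q k)"

definition generated :: "'a measure \<Rightarrow> 'b measure \<Rightarrow> ('a \<Rightarrow> 'b) \<Rightarrow> 'a set set" where
  "generated M N X = sets (vimage_algebra (space M) X N)"

abbreviation path_space :: "(int \<Rightarrow> nat) measure" where
  "path_space \<equiv> Pi\<^sub>M UNIV (\<lambda>_. count_space UNIV)"

definition indep_of_innovations :: "'a measure \<Rightarrow> (int \<Rightarrow> 'a \<Rightarrow> nat) \<Rightarrow> ('a \<Rightarrow> nat) \<Rightarrow> bool" where
  "indep_of_innovations M eps V \<longleftrightarrow>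
     prob_space.indep_set M (generated M (count_space UNIV) V)
       (generated M path_space (\<lambda>\<omega> i. eps i \<omega>))"

(* Mutual independence of V, V' and the whole sequence eps, stated on generated sigma-algebras
   because the library's indep_vars needs a common value type. *)
definition stationary_pair ::
    "'a measure \<Rightarrow> (int \<Rightarrow> 'a \<Rightarrow> nat) \<Rightarrow> ('a \<Rightarrow> nat) \<Rightarrow> ('a \<Rightarrow> nat) \<Rightarrow> bool" where
  "stationary_pair M eps V V' \<longleftrightarrow>
     prob_space.indep_sets M
       (\<lambda>j. [generated M (count_space UNIV) V,
             generated M (count_space UNIV) V',
             generated M path_space (\<lambda>\<omega> i. eps i \<omega>)] ! j) {..<3} \<and>
     (\<forall>j. measure M {\<omega> \<in> space M. V \<omega> = j} = stationary_weight M (eps 1) j) \<and>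
     (\<forall>j. measure M {\<omega> \<in> space M. V' \<omega> = j} = stationary_weight M (eps 1) j)"

(* Degenerate (almost surely constant) variables count as Gaussian. *)
definition gaussian_rv :: "'a measure \<Rightarrow> ('a \<Rightarrow> real) \<Rightarrow> bool" where
  "gaussian_rv M X \<longleftrightarrow> X \<in> borel_measurable M \<and>
     ((\<exists>\<mu>. AE \<omega> in M. X \<omega> = \<mu>) \<or>
      (\<exists>\<mu> \<sigma>. \<sigma> > 0 \<and> distributed M lborel X (\<lambda>x. ennreal (normal_density \<mu> \<sigma> x))))"

definition gaussian_sequence :: "'a measure \<Rightarrow> (int \<Rightarrow> 'a \<Rightarrow> real) \<Rightarrow> bool" where
  "gaussian_sequence M g \<longleftrightarrow>
     (\<forall>J c. finite J \<longrightarrow> gaussian_rv M (\<lambda>\<omega>. \<Sum>k\<in>J. c k * g k \<omega>))"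

definition stationary_sequence :: "'a measure \<Rightarrow> (int \<Rightarrow> 'a \<Rightarrow> real) \<Rightarrow> bool" where
  "stationary_sequence M g \<longleftrightarrow>
     (\<forall>h. distr M (Pi\<^sub>M UNIV (\<lambda>_. borel)) (\<lambda>\<omega> k. g (k + h) \<omega>) =
          distr M (Pi\<^sub>M UNIV (\<lambda>_. borel)) (\<lambda>\<omega> k. g k \<omega>))"

definition centered_sequence :: "'a measure \<Rightarrow> (int \<Rightarrow> 'a \<Rightarrow> real) \<Rightarrow> bool" where
  "centered_sequence M g \<longleftrightarrow> (\<forall>k. integrable M (g k) \<and> (\<integral>\<omega>. g k \<omega> \<partial>M) = 0)"

definition covariance :: "'a measure \<Rightarrow> ('a \<Rightarrow> real) \<Rightarrow> ('a \<Rightarrow> real) \<Rightarrow> real" where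
  "covariance M X Y =
     (\<integral>\<omega>. (X \<omega> - (\<integral>\<omega>'. X \<omega>' \<partial>M)) * (Y \<omega> - (\<integral>\<omega>'. Y \<omega>' \<partial>M)) \<partial>M)"

end

theory Submission
  imports Defs
begin

text \<open>
  The state of the chain is the remaining time until the next zero, and at a zero the next
  innovation is the gap to the following one. All three assertions reflect the tails of order
  \<open>n powr - p\<close> of the innovations, which give the stationary law tails of order \<open>n powr (1 - p)\<close>.

  Divergence of the first series: if \<open>V\<close> exceeds \<open>2 * n\<close>, the first chain stays above \<open>n\<close> during \<open>n\<close>
  steps, and the other chain can hit it only through a single, very unlikely value of each innovation.
  Hence the meeting time is at least \<open>n\<close> with probability at least of order \<open>n powr (1 - p)\<close>
  (\<open>prob_meeting_lower\<close>), and the series dominates the harmonic series.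

  Convergence of the second series: as long as the chains have not met, at most one of them is at zero,
  so the conditional mean change of their sum is at most \<open>mu - 2\<close>. As \<open>p > 2\<close>, the mean \<open>mu\<close> of an innovation
  is less than 2. The sum of the chains plus a small multiple of the elapsed time plus a constant, raised to
  the power \<open>q = p - 1/2\<close>, is therefore a supermartingale up to the meeting time
  (\<open>coupled_moment_step\<close>). Truncating the initial states at \<open>n\<close> yields the upper bound of order
  \<open>n powr (1 - p)\<close> for the tail of the meeting time (\<open>prob_meeting_upper\<close>), and Bertrand's series
  converges.

  Approximation error: almost surely, for infinitely many \<open>j\<close> the chain is at zero at time \<open>j\<close> and then jumps
  above \<open>(j * ln j) powr (1 / p)\<close>, up to constants, since the probabilities of such jumps are of order
  \<open>1 / (j * ln j)\<close> (\<open>long_jumps_from_zero_infinitely_often\<close>). Over the excursion that follows, of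
  length \<open>t\<close>, the centred counting sum moves linearly by \<open>- nu 0 * t\<close>, whereas the block sums of the
  Gaussian sequence are eventually at most \<open>nu 0 * t / 2\<close> in absolute value, whatever the joint law
  (\<open>blocks_eventually_small\<close>).
\<close>

section \<open>Numerical series\<close>

text \<open>Tails of the series of \<open>n powr - s\<close> are compared with \<open>n powr (1 - s)\<close>: from above by
telescoping, from below by the first \<open>n\<close> terms, each of which is at least \<open>(2 * n) powr - s\<close>.\<close>

lemma powr_telescope_le:
  fixes x s :: real
  assumes "x > 0" "s > 1"
  shows "(x + 1) powr - s \<le> (x powr (1 - s) - (x + 1) powr (1 - s)) / (s - 1)"
proof -
  have "\<exists>z>x. z < x + 1 \<and> (x + 1) powr (1 - s) - x powr (1 - s) = (x + 1 - x) * ((1 - s) * z powr (1 - s - 1))"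
    by (rule MVT2) (use assms in \<open>auto intro!: derivative_eq_intros\<close>)
  then obtain z where z: "z > x" "z < x + 1"
    "(x + 1) powr (1 - s) - x powr (1 - s) = (1 - s) * z powr (- s)" by auto
  have "(x + 1) powr - s \<le> z powr - s"
    using z assms by (intro powr_mono2') auto
  moreover have "(x powr (1 - s) - (x + 1) powr (1 - s)) / (s - 1) = z powr - s"
    using z(3) assms by (simp add: field_simps)
  ultimately show ?thesis by simp
qed

lemma summable_shifted_powr:
  fixes s :: real
  assumes "s > 1"
  shows "summable (\<lambda>i. real (n + i) powr - s)"
  using summable_iff_shift[of "\<lambda>i. real i powr - s" n] summable_real_powr_iff[of "- s"] assms
  by (simp add: add.commute)

lemma powr_tail_upper:
  fixes s :: real
  assumes "s > 1" "n \<ge> 1"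
  shows "(\<Sum>i. real (n + 1 + i) powr - s) \<le> real n powr (1 - s) / (s - 1)"
proof (rule suminf_le_const)
  show "summable (\<lambda>i. real (n + 1 + i) powr - s)"
    using summable_shifted_powr[OF assms(1)] by blast
  fix N
  have "(\<Sum>i<N. real (n + 1 + i) powr - s) \<le> (real n powr (1 - s) - real (n + N) powr (1 - s)) / (s - 1)"
  proof (induction N)
    case (Suc N)
    have "real (n + 1 + N) powr - s \<le> (real (n + N) powr (1 - s) - real (n + Suc N) powr (1 - s)) / (s - 1)"
      using powr_telescope_le[of "real (n + N)" s] assms by (simp add: add_ac)
    with Suc show ?case by (simp add: diff_divide_distrib)
  qed simp
  also have "\<dots> \<le> real n powr (1 - s) / (s - 1)"
    using assms by (intro divide_right_mono) auto
  finally show "(\<Sum>i<N. real (n + 1 + i) powr - s) \<le> real n powr (1 - s) / (s - 1)" .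
qed

lemma powr_tail_lower:
  fixes s :: real
  assumes "s > 1" "n \<ge> 1"
  shows "2 powr - s * real n powr (1 - s) \<le> (\<Sum>i. real (n + 1 + i) powr - s)"
proof -
  have "2 powr - s * real n powr (1 - s) = (\<Sum>i<n. real (2 * n) powr - s)"
    using assms by (simp add: powr_mult powr_diff powr_minus field_simps)
  also have "\<dots> \<le> (\<Sum>i<n. real (n + 1 + i) powr - s)"
    using assms by (intro sum_mono powr_mono2') auto
  also have "\<dots> \<le> (\<Sum>i. real (n + 1 + i) powr - s)"
    using summable_shifted_powr[OF assms(1), of "n + 1"] by (intro sum_le_suminf) auto
  finally show ?thesis .
qed

lemma sum_inverse_sqrt_le: "(\<Sum>j = 1..n. real j powr - (1/2)) \<le> 2 * real n powr (1/2)"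
proof (induction n)
  case (Suc n)
  define a b where "a = sqrt (real n)" and "b = sqrt (real (Suc n))"
  have b: "b > 0" "a \<ge> 0" "a \<le> b" by (auto simp: a_def b_def)
  have "b * b - a * a = 1" by (simp add: a_def b_def)
  then have "1 = (b - a) * (b + a)" by (simp add: algebra_simps)
  also have "\<dots> \<le> (b - a) * (2 * b)" using b by (intro mult_left_mono) auto
  finally have "1 / b \<le> 2 * (b - a)" using b by (simp add: field_simps)
  moreover have "real (Suc n) powr - (1/2) = 1 / b"
    by (simp add: b_def powr_minus powr_half_sqrt field_simps del: of_nat_Suc)
  ultimately show ?case using Suc
    by (simp add: a_def b_def powr_half_sqrt del: of_nat_Suc)
qed simp

text \<open>Bertrand's series. The logarithm is shifted by one so that the terms decrease from \<open>n = 1\<close> on, as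
Cauchy condensation requires.\<close>

lemma summable_bertrand_iff:
  fixes a :: real
  assumes "a \<ge> 1"
  shows "summable (\<lambda>n. 1 / (real n * (1 + ln (real n)) powr a)) \<longleftrightarrow> a > 1"
proof -
  have "summable (\<lambda>n. 1 / (real n * (1 + ln (real n)) powr a)) \<longleftrightarrow>
        summable (\<lambda>n. 2 ^ n * (1 / (real (2 ^ n) * (1 + ln (real (2 ^ n))) powr a)))"
  proof (rule condensation_test)
    fix m :: nat assume "0 < m"
    then have "1 + ln (real m) > 0" "1 + ln (1 + real m) > 0"
      by (auto intro!: add_pos_nonneg)
    with \<open>0 < m\<close> show "1 / (real (Suc m) * (1 + ln (real (Suc m))) powr a) \<le> 1 / (real m * (1 + ln (real m)) powr a)"
      using assms by (intro divide_left_mono mult_mono powr_mono2 mult_pos_pos) auto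
  next
    fix n :: nat
    show "1 / (real n * (1 + ln (real n)) powr a) \<ge> 0" by simp
  qed
  also have "\<dots> \<longleftrightarrow> summable (\<lambda>n. (1 + real n * ln 2) powr - a)"
    by (simp add: ln_realpow powr_minus field_simps)
  also have "\<dots> \<longleftrightarrow> a > 1"
  proof
    assume *: "summable (\<lambda>n. (1 + real n * ln 2) powr - a)"
    have l2: "ln 2 \<le> (1::real)" using ln_le_minus_one[of "2::real"] by simp
    have "summable (\<lambda>n. real (n + 1) powr - a)"
    proof (rule summable_comparison_test'[OF *])
      fix n :: nat
      have "real n * ln 2 \<le> real n * 1" using l2 by (intro mult_left_mono) auto
      then show "norm (real (n + 1) powr - a) \<le> (1 + real n * ln 2) powr - a"
        using assms by (auto intro!: powr_mono2' simp: add_pos_nonneg)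
    qed
    then show "a > 1"
      using summable_iff_shift[of "\<lambda>i. real i powr - a" 1] summable_real_powr_iff[of "- a"] by simp
  next
    assume "a > 1"
    then have "summable (\<lambda>n. 2 powr a * real n powr - a)"
      using summable_real_powr_iff[of "- a"] by (intro summable_mult) simp
    then show "summable (\<lambda>n. (1 + real n * ln 2) powr - a)"
    proof (rule summable_comparison_test'[where N = 1])
      fix n :: nat assume n: "n \<ge> 1"
      have "real n / 2 \<le> real n * ln 2" using ln2_ge_two_thirds mult_left_mono[of "1/2" "ln 2" "real n"] by simp
      then have "(1 + real n * ln 2) powr - a \<le> (real n / 2) powr - a"
        using n assms \<open>real n / 2 \<le> _\<close> by (intro powr_mono2') linarith+
      then show "norm ((1 + real n * ln 2) powr - a) \<le> 2 powr a * real n powr - a"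
        using n by (simp add: powr_divide powr_minus field_simps)
    qed
  qed
  finally show ?thesis .
qed

lemma one_plus_powr_diff_le:
  fixes t q :: real
  assumes "q \<ge> 1" "t \<ge> - 1"
  shows "\<bar>(1 + t) powr q - 1\<bar> \<le> q * \<bar>t\<bar> * (1 + \<bar>t\<bar>) powr (q - 1)"
proof (cases "t = 0")
  case False
  define a b where "a = min 1 (1 + t)" and "b = max 1 (1 + t)"
  have ab: "a < b" "0 \<le> a" "b > 0" "b \<le> 1 + \<bar>t\<bar>" "b - a = \<bar>t\<bar>"
    using assms False by (auto simp: a_def b_def)
  obtain z where z: "a < z" "z < b" "b powr q - a powr q = q * z powr (q - 1) * (b - a)"
  proof (rule mvt[of a b "\<lambda>x. x powr q" "\<lambda>z. (*) (q * z powr (q - 1))"])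
    show "a < b" by fact
    show "continuous_on {a..b} (\<lambda>x. x powr q)"
      using ab assms by (intro continuous_on_powr' continuous_intros) auto
    show "((\<lambda>x. x powr q) has_derivative (*) (q * x powr (q - 1))) (at x)" if "a < x" "x < b" for x
      using that ab has_real_derivative_powr[of x q]
      by (auto simp: has_field_derivative_def mult_ac)
  qed auto
  have "\<bar>(1 + t) powr q - 1\<bar> = \<bar>b powr q - a powr q\<bar>"
    by (auto simp: a_def b_def min_def max_def)
  also have "\<dots> = q * \<bar>t\<bar> * z powr (q - 1)"
    using z ab assms by simp
  also have "\<dots> \<le> q * \<bar>t\<bar> * (1 + \<bar>t\<bar>) powr (q - 1)"
    using z ab assms by (intro mult_left_mono powr_mono2) auto
  finally show ?thesis .
qed simp

section \<open>Powers of a random walk with negative drift\<close>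

text \<open>If \<open>Y\<close> is bounded below with negative mean and a moment of order \<open>q\<close>, then \<open>y powr q\<close> does not
increase in mean under a step \<open>Y\<close> from any sufficiently large \<open>y\<close>. Indeed \<open>y * ((1 + Y / y) powr q - 1)\<close> tends to
\<open>q * Y\<close> as \<open>y\<close> grows, and dominated convergence applies.\<close>

lemma (in prob_space) negative_drift_powr:
  fixes Y :: "'a \<Rightarrow> real" and q K :: real
  assumes q: "q \<ge> 1" and Y: "integrable M Y" and neg: "expectation Y < 0"
    and low: "\<And>\<omega>. Y \<omega> \<ge> - K"
    and mom: "integrable M (\<lambda>\<omega>. (1 + \<bar>Y \<omega>\<bar>) powr q)"
  shows "\<exists>B\<ge>K. B \<ge> 1 \<and> (\<forall>y\<ge>B. (\<integral>\<^sup>+\<omega>. ennreal ((y + Y \<omega>) powr q) \<partial>M) \<le> ennreal (y powr q))"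
proof -
  have [measurable]: "Y \<in> borel_measurable M" using Y by simp
  \<comment> \<open>The increment of \<open>y powr q\<close> divided by \<open>y powr (q - 1)\<close>.\<close>
  define g where "g y \<omega> = y * ((1 + Y \<omega> / y) powr q - 1)" for y \<omega>
  have meas [measurable]: "g y \<in> borel_measurable M" for y
    unfolding g_def[abs_def] by measurable
  have bound: "\<bar>g y \<omega>\<bar> \<le> q * (1 + \<bar>Y \<omega>\<bar>) powr q" if y: "y \<ge> 1" "y \<ge> K" for y \<omega>
  proof -
    have "- y \<le> Y \<omega>" using low[of \<omega>] y by simp
    then have "Y \<omega> / y \<ge> - 1" using y by (simp add: field_simps)
    then have "\<bar>g y \<omega>\<bar> \<le> y * (q * \<bar>Y \<omega> / y\<bar> * (1 + \<bar>Y \<omega> / y\<bar>) powr (q - 1))"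
      unfolding g_def abs_mult using y q one_plus_powr_diff_le[of q "Y \<omega> / y"]
      by (intro mult_mono) auto
    also have "\<dots> = q * \<bar>Y \<omega>\<bar> * (1 + \<bar>Y \<omega>\<bar> / y) powr (q - 1)"
      using y by (simp add: abs_divide)
    also have "\<dots> \<le> q * (1 + \<bar>Y \<omega>\<bar>) * (1 + \<bar>Y \<omega>\<bar>) powr (q - 1)"
    proof (intro mult_mono powr_mono2)
      show "1 + \<bar>Y \<omega>\<bar> / y \<le> 1 + \<bar>Y \<omega>\<bar>" using y by (simp add: field_simps mult_le_cancel_right1)
    qed (use q y in auto)
    also have "\<dots> = q * (1 + \<bar>Y \<omega>\<bar>) powr q"
      by (simp add: powr_diff)
    finally show ?thesis .
  qed
  have lim: "((\<lambda>y. g y \<omega>) \<longlongrightarrow> q * Y \<omega>) at_top" for \<omega>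
  proof -
    have "((\<lambda>t. (1 + t * Y \<omega>) powr q) has_real_derivative (q * Y \<omega>)) (at 0)"
      by (auto intro!: derivative_eq_intros)
    then have "((\<lambda>t. ((1 + t * Y \<omega>) powr q - 1) / t) \<longlongrightarrow> q * Y \<omega>) (at 0)"
      by (simp add: has_field_derivative_iff)
    then have "((\<lambda>t. ((1 + t * Y \<omega>) powr q - 1) / t) \<longlongrightarrow> q * Y \<omega>) (at_right 0)"
      by (rule filterlim_mono) (auto simp: at_within_le_at)
    then have "((\<lambda>y. ((1 + inverse y * Y \<omega>) powr q - 1) / inverse y) \<longlongrightarrow> q * Y \<omega>) at_top"
      by (rule filterlim_compose[OF _ filterlim_inverse_at_right_top])
    then show ?thesis by (simp add: g_def field_simps)
  qed
  have "((\<lambda>y. \<integral>\<omega>. g y \<omega> \<partial>M) \<longlongrightarrow> (\<integral>\<omega>. q * Y \<omega> \<partial>M)) at_top"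
  proof (rule integral_dominated_convergence_at_top[where w = "\<lambda>\<omega>. q * (1 + \<bar>Y \<omega>\<bar>) powr q"])
    show "\<forall>\<^sub>F y in at_top. AE \<omega> in M. norm (g y \<omega>) \<le> q * (1 + \<bar>Y \<omega>\<bar>) powr q"
      using eventually_ge_at_top[of "max 1 K"] by eventually_elim (use bound in auto)
    show "AE \<omega> in M. ((\<lambda>y. g y \<omega>) \<longlongrightarrow> q * Y \<omega>) at_top" using lim by simp
  qed (use mom in \<open>auto simp: g_def\<close>)
  moreover have "(\<integral>\<omega>. q * Y \<omega> \<partial>M) < 0" using neg q by (simp add: mult_pos_neg)
  ultimately have "\<forall>\<^sub>F y in at_top. (\<integral>\<omega>. g y \<omega> \<partial>M) < 0"
    by (rule order_tendstoD(2))
  then obtain B0 where B0: "\<And>y. y \<ge> B0 \<Longrightarrow> (\<integral>\<omega>. g y \<omega> \<partial>M) < 0"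
    by (auto simp: eventually_at_top_linorder)
  define B where "B = max B0 (max 1 K)"
  show ?thesis
  proof (intro exI[of _ B] conjI allI impI)
    fix y assume "y \<ge> B"
    then have y: "y \<ge> 1" "y \<ge> K" "y \<ge> B0" by (auto simp: B_def)
    have int: "integrable M (g y)"
      by (rule Bochner_Integration.integrable_bound[OF integrable_mult_right[OF mom, of q]])
         (use bound[OF y(1,2)] q in \<open>auto intro: order_trans\<close>)
    have eq: "(y + Y \<omega>) powr q = y powr q + y powr (q - 1) * g y \<omega>" for \<omega>
    proof -
      have "- y \<le> Y \<omega>" using low[of \<omega>] y by simp
      then have "1 + Y \<omega> / y \<ge> 0" using y by (simp add: field_simps)
      then have "(y * (1 + Y \<omega> / y)) powr q = y powr q * (1 + Y \<omega> / y) powr q"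
        using y by (subst powr_mult) auto
      moreover have "y * (1 + Y \<omega> / y) = y + Y \<omega>" using y by (simp add: field_simps)
      ultimately have "(y + Y \<omega>) powr q = y powr q * (1 + Y \<omega> / y) powr q" by metis
      moreover have "y powr (q - 1) * y = y powr q" using y by (simp add: powr_diff)
      ultimately show ?thesis
        by (simp add: g_def algebra_simps flip: mult.assoc)
    qed
    have "integrable M (\<lambda>\<omega>. (y + Y \<omega>) powr q)" using int by (simp add: eq)
    then have "(\<integral>\<^sup>+\<omega>. ennreal ((y + Y \<omega>) powr q) \<partial>M) = ennreal (\<integral>\<omega>. (y + Y \<omega>) powr q \<partial>M)"
      by (intro nn_integral_eq_integral) auto
    also have "(\<integral>\<omega>. (y + Y \<omega>) powr q \<partial>M) = y powr q + y powr (q - 1) * (\<integral>\<omega>. g y \<omega> \<partial>M)"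
      using int by (simp add: eq prob_space)
    also have "ennreal \<dots> \<le> ennreal (y powr q)"
      using B0[OF y(3)] y by (intro ennreal_leI) (simp add: mult_nonneg_nonpos)
    finally show "(\<integral>\<^sup>+\<omega>. ennreal ((y + Y \<omega>) powr q) \<partial>M) \<le> ennreal (y powr q)" .
  qed (auto simp: B_def)
qed

section \<open>The law of the innovations and the stationary law\<close>

lemma (in prob_space) nat_rv_tail_sums:
  fixes X :: "'a \<Rightarrow> nat"
  assumes [measurable]: "X \<in> measurable M (count_space UNIV)"
  shows "(\<lambda>i. prob {\<omega> \<in> space M. X \<omega> = n + i}) sums prob {\<omega> \<in> space M. X \<omega> \<ge> n}"
proof -
  have "(\<lambda>i. prob {\<omega> \<in> space M. X \<omega> = n + i}) sums prob (\<Union>i. {\<omega> \<in> space M. X \<omega> = n + i})"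
    by (rule finite_measure_UNION) (auto simp: disjoint_family_on_def)
  also have "(\<Union>i. {\<omega> \<in> space M. X \<omega> = n + i}) = {\<omega> \<in> space M. X \<omega> \<ge> n}"
    by (auto simp: le_iff_add)
  finally show ?thesis .
qed

lemma (in prob_space) nn_integral_countable_rv:
  fixes X :: "'a \<Rightarrow> 'c :: countable" and f :: "'c \<Rightarrow> ennreal"
  assumes X [measurable]: "X \<in> measurable M (count_space UNIV)"
  shows "(\<integral>\<^sup>+\<omega>. f (X \<omega>) \<partial>M) =
         (\<integral>\<^sup>+x. f x * ennreal (prob {\<omega> \<in> space M. X \<omega> = x}) \<partial>count_space UNIV)"
proof -
  have "distr M (count_space UNIV) X =
        density (count_space UNIV) (\<lambda>x. ennreal (prob {\<omega> \<in> space M. X \<omega> = x}))"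
    by (rule measure_eqI_countable[where A = UNIV])
       (auto simp: emeasure_distr emeasure_eq_measure emeasure_density vimage_def Int_def
          conj_commute nn_integral_count_space_indicator[symmetric] one_ennreal_def[symmetric])
  moreover have "(\<integral>\<^sup>+\<omega>. f (X \<omega>) \<partial>M) = (\<integral>\<^sup>+x. f x \<partial>distr M (count_space UNIV) X)"
    by (subst nn_integral_distr) auto
  ultimately show ?thesis by (simp add: nn_integral_density mult.commute)
qed

text \<open>The normalising constant, that is the value of the Riemann zeta function at \<open>p + 1\<close>.\<close>

definition zeta_sum :: "real \<Rightarrow> real" where
  "zeta_sum p = (\<Sum>i. real (Suc i) powr - (p + 1))"

lemma zeta_weight_eq: "zeta_weight p k = real k powr - (p + 1) / zeta_sum p"
  unfolding zeta_weight_def zeta_sum_def powr_minus by (simp add: field_simps)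

text \<open>Independent innovations whose common law has weights proportional to \<open>k powr - (p + 1)\<close>.\<close>

locale zeta_innovations = prob_space M for M :: "'a measure" +
  fixes p :: real and eps :: "int \<Rightarrow> 'a \<Rightarrow> nat"
  assumes p_gt_2: "p > 2" and iid: "iid_innovations M eps (zeta_weight p)"
begin

lemma zeta_sum_ge_1: "zeta_sum p \<ge> 1"
proof -
  have "(\<Sum>i<1. real (Suc i) powr - (p + 1)) \<le> zeta_sum p"
    unfolding zeta_sum_def using summable_shifted_powr[of "p + 1" 1] p_gt_2
    by (intro sum_le_suminf) auto
  then show ?thesis by simp
qed

lemma zeta_weight_nonneg [simp]: "zeta_weight p k \<ge> 0"
  using zeta_sum_ge_1 by (simp add: zeta_weight_eq)

lemma zeta_weight_le: "zeta_weight p k \<le> real k powr - (p + 1)"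
  using frac_le[of "real k powr - (p + 1)" "real k powr - (p + 1)" 1 "zeta_sum p"] zeta_sum_ge_1
  by (simp add: zeta_weight_eq)

lemma zeta_weight_tail_upper:
  assumes "n \<ge> 1"
  shows "(\<Sum>i. zeta_weight p (n + 1 + i)) \<le> real n powr - p"
proof -
  have "(\<Sum>i. zeta_weight p (n + 1 + i)) = (\<Sum>i. real (n + 1 + i) powr - (p + 1)) / zeta_sum p"
    unfolding zeta_weight_eq using summable_shifted_powr[of "p + 1" "n + 1"] p_gt_2
    by (intro suminf_divide) auto
  also have "\<dots> \<le> (real n powr (1 - (p + 1)) / (p + 1 - 1)) / 1"
    using zeta_sum_ge_1 p_gt_2 assms by (intro frac_le powr_tail_upper) auto
  also have "\<dots> \<le> real n powr - p"
    using frac_le[of "real n powr - p" "real n powr - p" 1 p] p_gt_2 by simp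
  finally show ?thesis .
qed

text \<open>A constant such that the probability that an innovation exceeds \<open>n\<close> is at least this multiple of
\<open>n powr - p\<close>.\<close>

definition tail_const :: real where
  "tail_const = 2 powr - (p + 1) / zeta_sum p"

lemma tail_const_pos: "tail_const > 0"
  using zeta_sum_ge_1 by (simp add: tail_const_def)

lemma zeta_weight_tail_lower:
  assumes "n \<ge> 1"
  shows "tail_const * real n powr - p \<le> (\<Sum>i. zeta_weight p (n + 1 + i))"
proof -
  have "tail_const * real n powr - p = (2 powr - (p + 1) * real n powr (1 - (p + 1))) / zeta_sum p"
    by (simp add: tail_const_def)
  also have "\<dots> \<le> (\<Sum>i. real (n + 1 + i) powr - (p + 1)) / zeta_sum p"
    using zeta_sum_ge_1 p_gt_2 assms by (intro divide_right_mono powr_tail_lower) auto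
  also have "\<dots> = (\<Sum>i. zeta_weight p (n + 1 + i))"
    unfolding zeta_weight_eq using summable_shifted_powr[of "p + 1" "n + 1"] p_gt_2
    by (intro suminf_divide[symmetric]) auto
  finally show ?thesis .
qed

lemma indep_eps: "indep_vars (\<lambda>_. count_space UNIV) eps UNIV"
  using iid by (simp add: iid_innovations_def)

lemma measurable_eps [measurable]: "eps i \<in> measurable M (count_space UNIV)"
  using indep_eps by (auto simp: indep_vars_def)

text \<open>The hypothesis only prescribes the probabilities of \<open>k \<ge> 1\<close>. They add up to one, so the value 0
has probability zero, which is also what \<^const>\<open>zeta_weight\<close> returns at 0.\<close>

lemma prob_eps: "prob {\<omega> \<in> space M. eps i \<omega> = k} = zeta_weight p k"
proof (cases "k = 0")
  case False
  then show ?thesis using iid by (simp add: iid_innovations_def)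
next
  case True
  have pos: "prob {\<omega> \<in> space M. eps i \<omega> = 1 + k} = zeta_weight p (1 + k)" for k
    using iid by (simp add: iid_innovations_def)
  have "(\<lambda>k. prob {\<omega> \<in> space M. eps i \<omega> = 1 + k}) sums prob {\<omega> \<in> space M. eps i \<omega> \<ge> 1}"
    by (rule nat_rv_tail_sums) simp
  moreover have "(\<lambda>k. zeta_weight p (1 + k)) sums (zeta_sum p / zeta_sum p)"
    unfolding zeta_weight_eq
    using summable_sums[OF summable_shifted_powr[of "p + 1" 1]] p_gt_2
    by (intro sums_divide) (simp add: zeta_sum_def)
  ultimately have "prob {\<omega> \<in> space M. eps i \<omega> \<ge> 1} = 1"
    unfolding pos using zeta_sum_ge_1 by (simp add: sums_iff)
  then have "prob (space M - {\<omega> \<in> space M. eps i \<omega> \<ge> 1}) = 0"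
    by (subst prob_compl) auto
  also have "space M - {\<omega> \<in> space M. eps i \<omega> \<ge> 1} = {\<omega> \<in> space M. eps i \<omega> = 0}" by auto
  finally show ?thesis using True by (simp add: zeta_weight_eq)
qed

lemma prob_eps_tail: "prob {\<omega> \<in> space M. eps i \<omega> > t} = (\<Sum>k. zeta_weight p (t + 1 + k))"
  using nat_rv_tail_sums[OF measurable_eps[of i], of "t + 1"]
  by (simp add: prob_eps sums_iff Suc_le_eq)

lemma distr_eps: "distr M (count_space UNIV) (eps i) = distr M (count_space UNIV) (eps j)"
  by (rule measure_eqI_countable[where A = UNIV])
     (simp_all add: emeasure_distr emeasure_eq_measure vimage_def Int_def conj_commute prob_eps)

lemma expectation_eps_cong:
  fixes f :: "nat \<Rightarrow> real"
  shows "expectation (\<lambda>\<omega>. f (eps i \<omega>)) = expectation (\<lambda>\<omega>. f (eps j \<omega>))"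
  using integral_distr[of "eps i" M "count_space UNIV" f] integral_distr[of "eps j" M "count_space UNIV" f]
  by (simp add: distr_eps[of i j])

lemma nn_integral_eps:
  fixes f :: "nat \<Rightarrow> ennreal"
  shows "(\<integral>\<^sup>+\<omega>. f (eps i \<omega>) \<partial>M) = (\<Sum>k. f k * ennreal (zeta_weight p k))"
  using nn_integral_countable_rv[OF measurable_eps[of i], of f]
  by (simp add: prob_eps nn_integral_count_space_nat)

lemma AE_eps_pos: "AE \<omega> in M. eps i \<omega> \<ge> 1"
proof (rule AE_I')
  show "{\<omega> \<in> space M. eps i \<omega> = 0} \<in> null_sets M"
    by (auto simp: null_sets_def emeasure_eq_measure prob_eps zeta_weight_eq)
qed auto

lemma integrable_eps:
  fixes f :: "nat \<Rightarrow> real"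
  assumes "q < p" "\<And>k. k \<ge> 1 \<Longrightarrow> \<bar>f k\<bar> \<le> C * real k powr q"
  shows "integrable M (\<lambda>\<omega>. f (eps i \<omega>))"
proof (rule integrableI_bounded)
  have C: "C \<ge> 0" using assms(2)[of 1] by simp
  have "(\<integral>\<^sup>+\<omega>. ennreal (norm (f (eps i \<omega>))) \<partial>M) = (\<Sum>k. ennreal \<bar>f k\<bar> * ennreal (zeta_weight p k))"
    using nn_integral_eps[of "\<lambda>k. ennreal \<bar>f k\<bar>"] by simp
  also have "\<dots> \<le> (\<Sum>k. ennreal (C * real k powr (q - (p + 1))))"
  proof (rule suminf_le)
    fix k
    show "ennreal \<bar>f k\<bar> * ennreal (zeta_weight p k) \<le> ennreal (C * real k powr (q - (p + 1)))"
    proof (cases "k = 0")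
      case False
      then have "\<bar>f k\<bar> * zeta_weight p k \<le> (C * real k powr q) * real k powr - (p + 1)"
        using assms(2)[of k] zeta_weight_le[of k] C by (intro mult_mono) auto
      also have "\<dots> = C * real k powr (q - (p + 1))"
        using False by (simp add: powr_diff powr_minus powr_add field_simps)
      finally show ?thesis by (simp add: ennreal_mult'[symmetric] ennreal_leI)
    qed (simp add: zeta_weight_eq)
  qed auto
  also have "\<dots> < \<infinity>"
    using summable_mult[of "\<lambda>k. real k powr (q - (p + 1))" C] summable_real_powr_iff[of "q - (p + 1)"] assms(1) C
    by (subst suminf_ennreal2) auto
  finally show "(\<integral>\<^sup>+\<omega>. ennreal (norm (f (eps i \<omega>))) \<partial>M) < \<infinity>" .
qed measurable

text \<open>The mean of an innovation.\<close>

definition mu :: real where "mu = expectation (\<lambda>\<omega>. real (eps 1 \<omega>))"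

lemma integrable_eps_1: "integrable M (\<lambda>\<omega>. real (eps i \<omega>))"
  using p_gt_2 by (intro integrable_eps[where q = 1 and C = 1 and f = real]) auto

lemma integrable_eps_2: "integrable M (\<lambda>\<omega>. (real (eps i \<omega>))\<^sup>2)"
  using p_gt_2 by (intro integrable_eps[where q = 2 and C = 1 and f = "\<lambda>k. (real k)\<^sup>2"]) auto

lemma expectation_eps: "expectation (\<lambda>\<omega>. real (eps i \<omega>)) = mu"
  unfolding mu_def using expectation_eps_cong[of real] .

lemma mu_ge_1: "mu \<ge> 1"
proof -
  have "expectation (\<lambda>_. 1) \<le> mu" unfolding mu_def
    using AE_eps_pos[of 1] by (intro integral_mono_AE integrable_eps_1) auto
  then show ?thesis by (simp add: prob_space)
qed

text \<open>This bound makes the sum of the two coupled chains drift downwards. The mean is at most the sum of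
\<open>k powr - p\<close> over \<open>k \<ge> 1\<close>, hence at most \<open>1 + 1 / (p - 1)\<close>.\<close>

lemma mu_less_2: "mu < 2"
proof -
  have sm: "summable (\<lambda>k. real k powr - p)"
    using summable_shifted_powr[of p 0] p_gt_2 by simp
  have "ennreal mu = (\<integral>\<^sup>+\<omega>. ennreal (real (eps 1 \<omega>)) \<partial>M)"
    unfolding mu_def by (intro nn_integral_eq_integral[symmetric] integrable_eps_1) auto
  also have "\<dots> = (\<Sum>k. ennreal (real k) * ennreal (zeta_weight p k))"
    by (rule nn_integral_eps)
  also have "\<dots> \<le> (\<Sum>k. ennreal (real k powr - p))"
  proof (rule suminf_le)
    fix k
    have "real k * zeta_weight p k \<le> real k * real k powr - (p + 1)"
      using zeta_weight_le by (intro mult_left_mono) auto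
    also have "\<dots> = real k powr - p"
      using powr_mult_base[of "real k" "- (p + 1)"] by simp
    finally show "ennreal (real k) * ennreal (zeta_weight p k) \<le> ennreal (real k powr - p)"
      by (simp add: ennreal_mult'[symmetric] ennreal_leI)
  qed auto
  also have "\<dots> = ennreal (\<Sum>k. real k powr - p)" using sm by (intro suminf_ennreal2) auto
  also have "(\<Sum>k. real k powr - p) = 1 + (\<Sum>k. real (1 + 1 + k) powr - p)"
    using suminf_split_initial_segment[OF sm, of 2] by (simp add: eval_nat_numeral add_ac)
  finally have "mu \<le> 1 + (\<Sum>k. real (1 + 1 + k) powr - p)"
    using summable_shifted_powr[of p "1 + 1"] p_gt_2
    by (subst (asm) ennreal_le_iff) (auto intro!: add_nonneg_nonneg suminf_nonneg)
  also have "\<dots> \<le> 1 + real 1 powr (1 - p) / (p - 1)"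
    using p_gt_2 by (intro add_left_mono powr_tail_upper) auto
  also have "\<dots> < 2" using p_gt_2 by simp
  finally show ?thesis .
qed

text \<open>The stationary law of the chain.\<close>

abbreviation nu :: "nat \<Rightarrow> real" where "nu \<equiv> stationary_weight M (eps 1)"

lemma nu_0: "nu 0 = 1 / mu" by (simp add: stationary_weight_def mu_def)

lemma nu_eq: "j \<ge> 1 \<Longrightarrow> nu j = (\<Sum>i. zeta_weight p (j + 1 + i)) / mu"
  by (simp add: stationary_weight_def mu_def[symmetric] prob_eps[simplified])

lemma nu_upper:
  assumes "j \<ge> 1" shows "nu j \<le> real j powr - p"
proof -
  have "nu j \<le> real j powr - p / 1"
    unfolding nu_eq[OF assms] using mu_ge_1 zeta_weight_tail_upper[OF assms] by (intro frac_le) auto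
  then show ?thesis by simp
qed

lemma nu_lower:
  assumes "j \<ge> 1" shows "tail_const / 2 * real j powr - p \<le> nu j"
proof -
  have "tail_const / 2 * real j powr - p = tail_const * real j powr - p / 2" by simp
  also have "\<dots> \<le> (\<Sum>i. zeta_weight p (j + 1 + i)) / mu"
    using mu_ge_1 mu_less_2 zeta_weight_tail_lower[OF assms] tail_const_pos
    by (intro frac_le) (auto intro: order_trans[rotated])
  finally show ?thesis using nu_eq[OF assms] by simp
qed

end

context zeta_innovations
begin

lemma level_generated:
  fixes Z :: "'a \<Rightarrow> nat"
  shows "{\<omega> \<in> space M. Z \<omega> = j} \<in> generated M (count_space UNIV) Z"
proof -
  have "Z -` {j} \<inter> space M \<in> generated M (count_space UNIV) Z"
    unfolding generated_def by (rule in_vimage_algebra) simp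
  then show ?thesis by (simp add: vimage_def Int_def conj_commute)
qed

lemma prob_eps_cylinder:
  assumes "finite J"
  shows "prob {\<omega> \<in> space M. \<forall>j\<in>J. eps j \<omega> = x j} = (\<Prod>j\<in>J. zeta_weight p (x j))"
proof (cases "J = {}")
  case False
  have "prob (\<Inter>j\<in>J. eps j -` {x j} \<inter> space M) = (\<Prod>j\<in>J. prob (eps j -` {x j} \<inter> space M))"
    using False assms by (intro indep_varsD[OF indep_eps]) auto
  also have "(\<Inter>j\<in>J. eps j -` {x j} \<inter> space M) = {\<omega> \<in> space M. \<forall>j\<in>J. eps j \<omega> = x j}"
    using False by auto
  also have "(\<Prod>j\<in>J. prob (eps j -` {x j} \<inter> space M)) = (\<Prod>j\<in>J. zeta_weight p (x j))"
    by (intro prod.cong refl) (simp add: prob_eps vimage_def Int_def conj_commute)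
  finally show ?thesis .
qed (simp add: prob_space)

lemma cylinder_generated:
  assumes "finite J"
  shows "{\<omega> \<in> space M. \<forall>j\<in>J. eps j \<omega> = x j} \<in> generated M path_space (\<lambda>\<omega> i. eps i \<omega>)"
proof -
  have "{f \<in> space path_space. \<forall>j\<in>J. f j = x j} \<in> sets path_space"
    using assms by measurable
  then have "(\<lambda>\<omega> i. eps i \<omega>) -` {f \<in> space path_space. \<forall>j\<in>J. f j = x j} \<inter> space M
    \<in> generated M path_space (\<lambda>\<omega> i. eps i \<omega>)"
    unfolding generated_def by (rule in_vimage_algebra)
  also have "(\<lambda>\<omega> i. eps i \<omega>) -` {f \<in> space path_space. \<forall>j\<in>J. f j = x j} \<inter> space M =
    {\<omega> \<in> space M. \<forall>j\<in>J. eps j \<omega> = x j}"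
    by (auto simp: space_PiM)
  finally show ?thesis .
qed

end

section \<open>Conditioning on the past\<close>

text \<open>Innovations together with an independent initial variable \<open>U\<close> with countably many values: the
initial state of one chain, or the pair of initial states of two coupled chains. Independence is
only required between the events \<open>U = u\<close> and the events generated by the innovations.\<close>

locale started_innovations = zeta_innovations M p eps
  for M :: "'a measure" and p eps +
  fixes U :: "'a \<Rightarrow> 'u :: countable"
  assumes measurable_U [measurable]: "U \<in> measurable M (count_space UNIV)"
    and indep_U: "\<And>u A. A \<in> generated M path_space (\<lambda>\<omega> i. eps i \<omega>) \<Longrightarrow>
      prob ({\<omega> \<in> space M. U \<omega> = u} \<inter> A) = prob {\<omega> \<in> space M. U \<omega> = u} * prob A"
begin

text \<open>The initial variable and the innovations up to time \<open>k\<close>. It takes countably many values.\<close>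

definition history :: "nat \<Rightarrow> 'a \<Rightarrow> 'u \<times> nat list" where
  "history k \<omega> = (U \<omega>, map (\<lambda>i. eps (int i) \<omega>) [1..<Suc k])"

text \<open>\<open>X\<close> is a function of the history up to time \<open>k\<close>. As the history takes countably many values, this
replaces measurability with respect to the past, for any value type.\<close>

definition determined :: "nat \<Rightarrow> ('a \<Rightarrow> 'b) \<Rightarrow> bool" where
  "determined k X \<longleftrightarrow> (\<exists>F. \<forall>\<omega>. X \<omega> = F (history k \<omega>))"

lemma measurable_history [measurable]: "history k \<in> measurable M (count_space UNIV)"
proof -
  have *: "(history k -` {h} \<inter> space M) \<in> sets M" for h
  proof (cases h)
    case (Pair u xs)
    have "(\<forall>i\<in>{..<k}. eps (int (Suc i)) \<omega> = xs ! i) \<longleftrightarrow> map (\<lambda>i. eps (int i) \<omega>) [1..<Suc k] = xs"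
      if "length xs = k" for \<omega>
      using that by (auto simp: list_eq_iff_nth_eq simp del: upt_Suc)
    then have "history k -` {h} \<inter> space M = (if length xs = k then {\<omega> \<in> space M. U \<omega> = u \<and> (\<forall>i\<in>{..<k}. eps (int (Suc i)) \<omega> = xs ! i)} else {})"
      unfolding Pair history_def by (auto simp del: upt_Suc)
    also have "\<dots> \<in> sets M"
    proof -
      have "{\<omega> \<in> space M. U \<omega> = u \<and> (\<forall>i\<in>{..<k}. eps (int (Suc i)) \<omega> = xs ! i)} \<in> sets M"
        by measurable
      then show ?thesis by simp
    qed
    finally show ?thesis .
  qed
  show ?thesis
    by (subst measurable_count_space_eq2_countable) (auto simp: *)
qed

lemma measurable_determined:
  assumes "determined k X" shows "(\<lambda>\<omega>. g (X \<omega>)) \<in> measurable M (count_space UNIV)"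
proof -
  obtain F where F: "\<And>\<omega>. X \<omega> = F (history k \<omega>)" using assms by (auto simp: determined_def)
  have "(\<lambda>h. g (F h)) \<circ> history k \<in> measurable M (count_space UNIV)"
    by (rule measurable_comp[OF measurable_history]) auto
  then show ?thesis by (simp add: F comp_def)
qed

lemma history_indep:
  "prob {\<omega> \<in> space M. history k \<omega> = h \<and> eps (int (Suc k)) \<omega> = y} =
   prob {\<omega> \<in> space M. history k \<omega> = h} * zeta_weight p y"
proof (cases h)
  case (Pair u xs)
  show ?thesis
  proof (cases "length xs = k")
    case False
    then have "history k \<omega> \<noteq> h" for \<omega> by (auto simp: Pair history_def)
    then show ?thesis by simp
  next
    case True
    define x where "x j = (if j = int (Suc k) then y else xs ! (nat j - 1))" for j
    define J where "J = int ` {1..k}"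
    have fin: "finite J" by (simp add: J_def)
    have notin: "int (Suc k) \<notin> J" by (auto simp: J_def)
    have hist: "history k \<omega> = h \<longleftrightarrow> U \<omega> = u \<and> (\<forall>j\<in>J. eps j \<omega> = x j)" for \<omega>
    proof -
      have "(\<forall>j\<in>J. eps j \<omega> = x j) \<longleftrightarrow> (\<forall>i\<in>{1..k}. eps (int i) \<omega> = xs ! (i - 1))"
        by (auto simp: J_def x_def)
      also have "\<dots> \<longleftrightarrow> (\<forall>i<k. eps (int (Suc i)) \<omega> = xs ! i)"
        unfolding image_Suc_lessThan[symmetric] by auto
      also have "\<dots> \<longleftrightarrow> map (\<lambda>i. eps (int i) \<omega>) [1..<Suc k] = xs"
        using True by (auto simp: list_eq_iff_nth_eq simp del: upt_Suc)
      finally show ?thesis by (auto simp: Pair history_def simp del: upt_Suc)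
    qed
    have "{\<omega> \<in> space M. history k \<omega> = h \<and> eps (int (Suc k)) \<omega> = y} =
      {\<omega> \<in> space M. U \<omega> = u} \<inter> {\<omega> \<in> space M. \<forall>j\<in>insert (int (Suc k)) J. eps j \<omega> = x j}"
      by (auto simp: hist x_def)
    moreover have "{\<omega> \<in> space M. history k \<omega> = h} =
      {\<omega> \<in> space M. U \<omega> = u} \<inter> {\<omega> \<in> space M. \<forall>j\<in>J. eps j \<omega> = x j}"
      by (auto simp: hist)
    moreover have "x (int (Suc k)) = y" by (simp add: x_def)
    ultimately show ?thesis
      using fin notin
      by (simp only: indep_U cylinder_generated prob_eps_cylinder finite_insert prod.insert[OF fin notin]
          mult_ac)
  qed
qed

text \<open>An expectation involving the past and the next innovation is bounded by integrating out the
innovation for a frozen value of the past.\<close>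

lemma nn_integral_history_step:
  fixes \<Phi> :: "'c \<Rightarrow> nat \<Rightarrow> ennreal"
  assumes X: "determined k X"
    and le: "\<And>x. (\<integral>\<^sup>+\<omega>. \<Phi> x (eps (int (Suc k)) \<omega>) \<partial>M) \<le> G x"
  shows "(\<integral>\<^sup>+\<omega>. \<Phi> (X \<omega>) (eps (int (Suc k)) \<omega>) \<partial>M) \<le> (\<integral>\<^sup>+\<omega>. G (X \<omega>) \<partial>M)"
proof -
  obtain F where F: "\<And>\<omega>. X \<omega> = F (history k \<omega>)" using X by (auto simp: determined_def)
  let ?C = "count_space UNIV"
  let ?P = "\<lambda>h. ennreal (prob {\<omega> \<in> space M. history k \<omega> = h})"
  have pair [measurable]: "(\<lambda>\<omega>. (history k \<omega>, eps (int (Suc k)) \<omega>)) \<in> measurable M ?C"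
  proof -
    have "(\<lambda>\<omega>. (history k \<omega>, eps (int (Suc k)) \<omega>)) -` {z} \<inter> space M =
      {\<omega> \<in> space M. history k \<omega> = fst z \<and> eps (int (Suc k)) \<omega> = snd z}" for z by auto
    moreover have "{\<omega> \<in> space M. history k \<omega> = h \<and> eps (int (Suc k)) \<omega> = y} \<in> sets M" for h y
      by measurable
    ultimately show ?thesis
      by (subst measurable_count_space_eq2_countable) auto
  qed
  have "(\<integral>\<^sup>+\<omega>. \<Phi> (X \<omega>) (eps (int (Suc k)) \<omega>) \<partial>M) =
    (\<integral>\<^sup>+z. \<Phi> (F (fst z)) (snd z) * ennreal (prob {\<omega> \<in> space M. (history k \<omega>, eps (int (Suc k)) \<omega>) = z}) \<partial>?C)"
    using nn_integral_countable_rv[OF pair, of "\<lambda>z. \<Phi> (F (fst z)) (snd z)"] by (simp add: F)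
  also have "\<dots> = (\<integral>\<^sup>+h. \<integral>\<^sup>+y. \<Phi> (F h) y * (?P h * ennreal (zeta_weight p y)) \<partial>?C \<partial>?C)"
    by (subst nn_integral_fst_count_space[symmetric]) (simp add: history_indep[simplified] ennreal_mult')
  also have "\<dots> = (\<integral>\<^sup>+h. ?P h * (\<integral>\<^sup>+y. \<Phi> (F h) y * ennreal (zeta_weight p y) \<partial>?C) \<partial>?C)"
    by (intro nn_integral_cong, subst nn_integral_cmult[symmetric]) (auto simp: mult_ac)
  also have "\<dots> = (\<integral>\<^sup>+h. ?P h * (\<integral>\<^sup>+\<omega>. \<Phi> (F h) (eps (int (Suc k)) \<omega>) \<partial>M) \<partial>?C)"
    by (simp only: nn_integral_eps nn_integral_count_space_nat)
  also have "\<dots> \<le> (\<integral>\<^sup>+h. ?P h * G (F h) \<partial>?C)"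
    by (intro nn_integral_mono mult_left_mono le) auto
  also have "\<dots> = (\<integral>\<^sup>+\<omega>. G (X \<omega>) \<partial>M)"
    using nn_integral_countable_rv[OF measurable_history, of "\<lambda>h. G (F h)" k] by (simp add: F mult.commute)
  finally show ?thesis .
qed

lemma determined_U: "determined k (\<lambda>\<omega>. f (U \<omega>))"
  unfolding determined_def by (rule exI[of _ "\<lambda>h. f (fst h)"]) (simp add: history_def)

lemma determined_Pair:
  assumes "determined k X" "determined k Y" shows "determined k (\<lambda>\<omega>. (X \<omega>, Y \<omega>))"
proof -
  obtain F G where "\<And>\<omega>. X \<omega> = F (history k \<omega>)" "\<And>\<omega>. Y \<omega> = G (history k \<omega>)"
    using assms by (auto simp: determined_def)
  then show ?thesis unfolding determined_def by (intro exI[of _ "\<lambda>h. (F h, G h)"]) simp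
qed

lemma determined_comp:
  assumes "determined k X" shows "determined k (\<lambda>\<omega>. f (X \<omega>))"
  using assms by (auto simp: determined_def)

lemma determined_comp2:
  assumes "determined k X" "determined k Y" shows "determined k (\<lambda>\<omega>. f (X \<omega>) (Y \<omega>))"
  using determined_comp[OF determined_Pair[OF assms], of "\<lambda>(x, y). f x y"] by simp

lemma determined_Suc:
  assumes "determined k X" shows "determined (Suc k) X"
proof -
  obtain F where "\<And>\<omega>. X \<omega> = F (history k \<omega>)" using assms by (auto simp: determined_def)
  then show ?thesis unfolding determined_def
    by (intro exI[of _ "\<lambda>h. F (fst h, butlast (snd h))"]) (simp add: history_def)
qed

lemma determined_event:
  assumes "determined k P" shows "{\<omega> \<in> space M. P \<omega>} \<in> events"
  using predE[OF measurable_determined[OF assms, of "\<lambda>b. b"]] by simp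

lemma determined_eps: "determined (Suc k) (eps (int (Suc k)))"
  unfolding determined_def by (rule exI[of _ "\<lambda>h. last (snd h)"]) (simp add: history_def)

lemma determined_chain: "determined k (chain (\<lambda>\<omega>. f (U \<omega>)) eps k)"
proof (induction k)
  case 0
  show ?case using determined_U[of 0 f] by (simp add: fun_eq_iff determined_def)
next
  case (Suc k)
  show ?case
    using determined_comp2[OF determined_Suc[OF Suc] determined_eps,
        of "\<lambda>w e. (w - 1) * of_bool (w \<noteq> 0) + (e - 1) * of_bool (w = 0)"]
    by (simp add: determined_def)
qed

end

section \<open>Two coupled stationary chains\<close>

lemma meeting_time_ge_iff:
  "meeting_time W W' \<omega> \<ge> enat n \<longleftrightarrow> (\<forall>k<n. W k \<omega> \<noteq> W' k \<omega>)"
  unfolding meeting_time_def le_INF_iff by simp (meson not_less)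

lemma chain_descent:
  assumes "k \<le> V \<omega>" shows "chain V eps k \<omega> = V \<omega> - k"
  using assms by (induction k) auto

text \<open>Two chains driven by the same innovations, from independent initial states with the stationary
law.\<close>

locale stationary_coupling = zeta_innovations M p eps
  for M :: "'a measure" and p eps +
  fixes V V' :: "'a \<Rightarrow> nat"
  assumes pair: "stationary_pair M eps V V'"
begin

lemma prob_V: "prob {\<omega> \<in> space M. V \<omega> = j} = nu j"
  and prob_V': "prob {\<omega> \<in> space M. V' \<omega> = j} = nu j"
  using pair by (auto simp: stationary_pair_def)

text \<open>The three generated \<open>\<sigma>\<close>-algebras: of the two initial states and of the innovations.\<close>

abbreviation gen :: "nat \<Rightarrow> 'a set set" where
  "gen j \<equiv> [generated M (count_space UNIV) V, generated M (count_space UNIV) V',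
             generated M path_space (\<lambda>\<omega> i. eps i \<omega>)] ! j"

lemma indep_gen: "indep_sets gen {..<3}"
  using pair by (simp add: stationary_pair_def)

lemma measurable_V [measurable]: "V \<in> measurable M (count_space UNIV)"
  and measurable_V' [measurable]: "V' \<in> measurable M (count_space UNIV)"
proof -
  have "\<forall>i<3. gen i \<subseteq> events"
    using indep_gen unfolding indep_sets_def by auto
  from this[rule_format, of 0] this[rule_format, of 1] have "gen 0 \<subseteq> events" "gen 1 \<subseteq> events" by auto
  then have "{\<omega> \<in> space M. V \<omega> = j} \<in> events" "{\<omega> \<in> space M. V' \<omega> = j} \<in> events" for j
    using level_generated[of V j] level_generated[of V' j] by auto
  moreover have "f -` {j} \<inter> space M = {\<omega> \<in> space M. f \<omega> = j}" for f :: "'a \<Rightarrow> nat" and j by auto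
  ultimately show "V \<in> measurable M (count_space UNIV)" "V' \<in> measurable M (count_space UNIV)"
    by (auto simp: measurable_count_space_eq2_countable)
qed

lemma prob_start:
  assumes A: "A \<in> generated M path_space (\<lambda>\<omega> i. eps i \<omega>)"
  shows "prob ({\<omega> \<in> space M. V \<omega> = v \<and> V' \<omega> = v'} \<inter> A) = nu v * nu v' * prob A"
proof -
  let ?A = "\<lambda>j. [{\<omega> \<in> space M. V \<omega> = v}, {\<omega> \<in> space M. V' \<omega> = v'}, A] ! j"
  have 3: "{..<3::nat} = {0, 1, 2}" by auto
  have "prob (\<Inter>j\<in>{..<3}. ?A j) = (\<Prod>j\<in>{..<3}. prob (?A j))"
    by (rule indep_setsD[OF indep_gen]) (auto simp: 3 level_generated A)
  moreover have "(\<Inter>j\<in>{..<3}. ?A j) = {\<omega> \<in> space M. V \<omega> = v \<and> V' \<omega> = v'} \<inter> A"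
    unfolding 3 by auto
  ultimately show ?thesis by (simp add: 3 prob_V prob_V')
qed

lemma prob_start_1:
  assumes A: "A \<in> generated M path_space (\<lambda>\<omega> i. eps i \<omega>)"
  shows "prob ({\<omega> \<in> space M. V \<omega> = v} \<inter> A) = nu v * prob A"
proof -
  let ?A = "\<lambda>j. [{\<omega> \<in> space M. V \<omega> = v}, {}, A] ! j"
  have "prob (\<Inter>j\<in>{0, 2}. ?A j) = (\<Prod>j\<in>{0, 2}. prob (?A j))"
    by (rule indep_setsD[OF indep_gen]) (auto simp: level_generated A)
  then show ?thesis by (simp add: prob_V)
qed

lemma space_generated: "space M \<in> generated M path_space (\<lambda>\<omega> i. eps i \<omega>)"
  using sets.top[of "vimage_algebra (space M) (\<lambda>\<omega> i. eps i \<omega>) path_space"]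
  by (simp add: generated_def)

lemma prob_VV': "prob {\<omega> \<in> space M. V \<omega> = v \<and> V' \<omega> = v'} = nu v * nu v'"
proof -
  have "{\<omega> \<in> space M. V \<omega> = v \<and> V' \<omega> = v'} \<inter> space M = {\<omega> \<in> space M. V \<omega> = v \<and> V' \<omega> = v'}" by auto
  then show ?thesis using prob_start[OF space_generated, of v v'] by (simp add: prob_space)
qed

sublocale started_innovations M p eps "\<lambda>\<omega>. (V \<omega>, V' \<omega>)"
proof
  show "(\<lambda>\<omega>. (V \<omega>, V' \<omega>)) \<in> measurable M (count_space UNIV)"
  proof -
    have "(\<lambda>\<omega>. (V \<omega>, V' \<omega>)) -` {z} \<inter> space M = {\<omega> \<in> space M. V \<omega> = fst z \<and> V' \<omega> = snd z}" for z by auto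
    moreover have "{\<omega> \<in> space M. V \<omega> = v \<and> V' \<omega> = v'} \<in> sets M" for v v' by measurable
    ultimately show ?thesis by (subst measurable_count_space_eq2_countable) auto
  qed
next
  fix u and A assume "A \<in> generated M path_space (\<lambda>\<omega> i. eps i \<omega>)"
  then show "prob ({\<omega> \<in> space M. (V \<omega>, V' \<omega>) = u} \<inter> A) = prob {\<omega> \<in> space M. (V \<omega>, V' \<omega>) = u} * prob A"
    by (cases u) (simp add: prob_start prob_VV')
qed

abbreviation W :: "nat \<Rightarrow> 'a \<Rightarrow> nat" where "W \<equiv> chain V eps"
abbreviation W' :: "nat \<Rightarrow> 'a \<Rightarrow> nat" where "W' \<equiv> chain V' eps"

lemma determined_W: "determined k (W k)" and determined_W': "determined k (W' k)"
  using determined_chain[of k fst] determined_chain[of k snd] by simp_all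

text \<open>Up to time \<open>n\<close> the first chain only descends deterministically from \<open>V\<close>. The second one can hit it
only by leaving zero at some time \<open>k - 1\<close> with the innovation \<open>V - k + 1\<close>, which exceeds \<open>n\<close>.\<close>

lemma no_meeting:
  assumes V: "V \<omega> \<ge> 2 * n" "V' \<omega> \<noteq> V \<omega>"
    and e: "\<And>k. 1 \<le> k \<Longrightarrow> k < n \<Longrightarrow> eps (int k) \<omega> \<noteq> V \<omega> - k + 1"
  shows "meeting_time W W' \<omega> \<ge> enat n"
proof -
  have "k < n \<longrightarrow> W k \<omega> \<noteq> W' k \<omega>" for k
  proof (induction k)
    case (Suc k)
    show ?case
    proof
      assume k: "Suc k < n"
      have W: "W k \<omega> = V \<omega> - k" "W (Suc k) \<omega> = V \<omega> - Suc k"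
        by (rule chain_descent, use k V in linarith)+
      have ne: "W' k \<omega> \<noteq> V \<omega> - k" using Suc k unfolding W(1) by linarith
      have e: "eps (int (Suc k)) \<omega> \<noteq> V \<omega> - Suc k + 1" using e[of "Suc k"] k by linarith
      have "W' (Suc k) \<omega> = (if W' k \<omega> = 0 then eps (int (Suc k)) \<omega> - 1 else W' k \<omega> - 1)"
        by simp
      then show "W (Suc k) \<omega> \<noteq> W' (Suc k) \<omega>"
        using ne e k V(1) unfolding W(2) by (simp only: split: if_splits) linarith+
    qed
  qed (use V in simp)
  then show ?thesis by (simp add: meeting_time_ge_iff)
qed

lemma sets_meeting: "{\<omega> \<in> space M. meeting_time W W' \<omega> \<ge> enat n} \<in> events"
proof -
  have "{\<omega> \<in> space M. W k \<omega> \<noteq> W' k \<omega>} \<in> events" for k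
    by (rule determined_event[OF determined_comp2[OF determined_W determined_W']])
  then have "{\<omega> \<in> space M. \<forall>k\<in>{..<n}. W k \<omega> \<noteq> W' k \<omega>} \<in> events"
    by (rule sets.sets_Collect_finite_All) (rule finite_lessThan)
  then show ?thesis by (simp only: meeting_time_ge_iff lessThan_iff Ball_def)
qed

text \<open>For each \<open>w\<close> between \<open>2 * n\<close> and \<open>4 * n\<close>, on the event \<open>V = w\<close> a meeting before \<open>n\<close> has conditional
probability at most one half.\<close>

lemma prob_meeting_lower:
  assumes n: "n \<ge> 2"
  shows "tail_const / 2 * 4 powr - p * real n powr (1 - p) \<le> prob {\<omega> \<in> space M. meeting_time W W' \<omega> \<ge> enat n}"
proof -
  define E where "E w = {\<omega> \<in> space M. V \<omega> = w \<and> V' \<omega> \<noteq> w \<and> (\<forall>k\<in>{1..<n}. eps (int k) \<omega> \<noteq> w - k + 1)}" for w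
  have E [measurable]: "E w \<in> events" for w unfolding E_def by measurable
  have PE: "tail_const / 4 * (4 * real n) powr - p \<le> prob (E w)" if w: "w \<in> {2 * n..<4 * n}" for w
  proof -
    \<comment> \<open>The two exceptional events are equality of the initial states and a hit at some time \<open>k < n\<close>.\<close>
    let ?B = "\<lambda>k. {\<omega> \<in> space M. V \<omega> = w} \<inter> {\<omega> \<in> space M. \<forall>j\<in>{int k}. eps j \<omega> = w - k + 1}"
    have "{\<omega> \<in> space M. V \<omega> = w} \<subseteq> E w \<union> ({\<omega> \<in> space M. V \<omega> = w \<and> V' \<omega> = w} \<union> (\<Union>k\<in>{1..<n}. ?B k))"
      by (auto simp: E_def)
    then have "nu w \<le> prob (E w \<union> ({\<omega> \<in> space M. V \<omega> = w \<and> V' \<omega> = w} \<union> (\<Union>k\<in>{1..<n}. ?B k)))"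
      unfolding prob_V[symmetric] by (rule finite_measure_mono) measurable
    also have "\<dots> \<le> prob (E w) + prob ({\<omega> \<in> space M. V \<omega> = w \<and> V' \<omega> = w} \<union> (\<Union>k\<in>{1..<n}. ?B k))"
      by (rule measure_Un_le) measurable
    also have "prob ({\<omega> \<in> space M. V \<omega> = w \<and> V' \<omega> = w} \<union> (\<Union>k\<in>{1..<n}. ?B k)) \<le>
      prob {\<omega> \<in> space M. V \<omega> = w \<and> V' \<omega> = w} + prob (\<Union>k\<in>{1..<n}. ?B k)"
      by (rule measure_Un_le) measurable
    also have "prob (\<Union>k\<in>{1..<n}. ?B k) \<le> (\<Sum>k\<in>{1..<n}. prob (?B k))"
      by (rule finite_measure_subadditive_finite) auto
    also have "(\<Sum>k\<in>{1..<n}. prob (?B k)) \<le> (\<Sum>k\<in>{1..<n}. nu w * real n powr - (p + 1))"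
    proof (rule sum_mono)
      fix k assume k: "k \<in> {1..<n}"
      have "prob (?B k) = nu w * zeta_weight p (w - k + 1)"
        using prob_start_1[OF cylinder_generated[of "{int k}" "\<lambda>_. w - k + 1"], of w]
        unfolding prob_eps_cylinder[OF finite.insertI[OF finite.emptyI]] by simp
      also have "zeta_weight p (w - k + 1) \<le> real (w - k + 1) powr - (p + 1)"
        by (rule zeta_weight_le)
      also have "\<dots> \<le> real n powr - (p + 1)"
        using k w p_gt_2 by (intro powr_mono2') auto
      finally show "prob (?B k) \<le> nu w * real n powr - (p + 1)"
        by (simp add: prob_V[symmetric] mult_left_mono)
    qed
    also have "\<dots> = nu w * (real (n - 1) * real n powr - (p + 1))" by simp
    also have "\<dots> \<le> nu w * (1 / 4)"
    proof (rule mult_left_mono)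
      have "real (n - 1) * real n powr - (p + 1) \<le> real n * real n powr - (p + 1)"
        by (intro mult_right_mono) auto
      also have "\<dots> = real n powr - p" using powr_mult_base[of "real n" "- (p + 1)"] by simp
      also have "\<dots> \<le> 2 powr - p" using n p_gt_2 by (intro powr_mono2') auto
      also have "\<dots> \<le> 2 powr - 2" using p_gt_2 by (intro powr_mono) auto
      finally show "real (n - 1) * real n powr - (p + 1) \<le> 1 / 4" by (simp add: powr_minus)
    qed (simp add: prob_V[symmetric])
    also have "prob {\<omega> \<in> space M. V \<omega> = w \<and> V' \<omega> = w} \<le> nu w * (1 / 4)"
      unfolding prob_VV'
    proof (rule mult_left_mono)
      have "nu w \<le> real w powr - p" using w n by (intro nu_upper) auto
      also have "\<dots> \<le> 2 powr - p" using w n p_gt_2 by (intro powr_mono2') auto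
      also have "\<dots> \<le> 2 powr - 2" using p_gt_2 by (intro powr_mono) auto
      finally show "nu w \<le> 1 / 4" by (simp add: powr_minus)
    qed (simp add: prob_V[symmetric])
    finally have "nu w / 2 \<le> prob (E w)" by simp
    moreover have "(4 * real n) powr - p \<le> real w powr - p"
      using w n p_gt_2 by (intro powr_mono2') auto
    then have "tail_const / 2 * (4 * real n) powr - p \<le> tail_const / 2 * real w powr - p"
      using tail_const_pos by (intro mult_left_mono) auto
    moreover have "tail_const / 2 * real w powr - p \<le> nu w"
      using w n by (intro nu_lower) auto
    ultimately show ?thesis by simp
  qed
  have "tail_const / 2 * 4 powr - p * real n powr (1 - p) =
    (\<Sum>w\<in>{2 * n..<4 * n}. tail_const / 4 * (4 * real n) powr - p)"
    using n by (simp add: powr_mult powr_diff powr_minus field_simps)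
  also have "\<dots> \<le> (\<Sum>w\<in>{2 * n..<4 * n}. prob (E w))" by (rule sum_mono) (rule PE)
  also have "\<dots> = prob (\<Union>w\<in>{2 * n..<4 * n}. E w)"
    by (rule finite_measure_finite_Union[symmetric]) (auto simp: disjoint_family_on_def E_def[of _])
  also have "\<dots> \<le> prob {\<omega> \<in> space M. meeting_time W W' \<omega> \<ge> enat n}"
  proof (rule finite_measure_mono)
    show "(\<Union>w\<in>{2 * n..<4 * n}. E w) \<subseteq> {\<omega> \<in> space M. meeting_time W W' \<omega> \<ge> enat n}"
      by (auto simp: E_def intro!: no_meeting)
  qed (rule sets_meeting)
  finally show ?thesis .
qed

lemma meeting_series_diverges:
  "(\<Sum>n. ennreal (real (n + 1) powr (p - 2) *
     prob {\<omega> \<in> space M. meeting_time W W' \<omega> \<ge> enat (n + 1)})) = \<infinity>"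
proof (rule ccontr)
  let ?P = "\<lambda>n. prob {\<omega> \<in> space M. meeting_time W W' \<omega> \<ge> enat n}"
  define c where "c = tail_const / 2 * 4 powr - p"
  have c: "c > 0" using tail_const_pos by (simp add: c_def)
  assume "\<not> ?thesis"
  then have "summable (\<lambda>n. real (n + 1) powr (p - 2) * ?P (n + 1))"
    by (intro summable_suminf_not_top) auto
  then have "summable (\<lambda>n. c * (1 / real (n + 1)))"
  proof (rule summable_comparison_test'[where N = 1])
    fix n :: nat assume "n \<ge> 1"
    then have "c * real (n + 1) powr (1 - p) \<le> ?P (n + 1)"
      using prob_meeting_lower[of "n + 1"] by (simp add: c_def)
    then have "real (n + 1) powr (p - 2) * (c * real (n + 1) powr (1 - p)) \<le> real (n + 1) powr (p - 2) * ?P (n + 1)"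
      by (intro mult_left_mono) auto
    also have "real (n + 1) powr (p - 2) * (c * real (n + 1) powr (1 - p)) = c * real (n + 1) powr (p - 2 + (1 - p))"
      unfolding powr_add by simp
    also have "\<dots> = c * (1 / real (n + 1))" by (simp add: powr_minus field_simps)
    finally show "norm (c * (1 / real (n + 1))) \<le> real (n + 1) powr (p - 2) * ?P (n + 1)"
      using c by simp
  qed
  then have "summable (\<lambda>n. 1 / real (n + 1))"
    using c by (subst (asm) summable_cmult_iff) auto
  then have "summable (\<lambda>n. inverse (real (Suc n)))" by (simp add: inverse_eq_divide)
  then show False
    using not_summable_harmonic[where 'a = real] summable_Suc_iff[of "\<lambda>n. inverse (real n)"] by metis
qed

end

section \<open>The meeting time has tails of order \<open>n powr (1 - p)\<close>\<close>

context zeta_innovations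
begin

text \<open>A step in which exactly one of the coupled chains is at zero changes their sum by \<open>e - 2\<close>, where
\<open>e\<close> is the innovation. The surplus \<open>c\<close> pays for the elapsed time. The increment is written with the
truncated \<open>e - 1\<close>, as in the recursion of the chain.\<close>

lemma step_drift:
  assumes q: "1 \<le> q" "q < p"
  obtains c B :: real where "0 < c" "c \<le> 1" "1 \<le> B"
    "\<And>y i. y \<ge> B \<Longrightarrow>
      (\<integral>\<^sup>+\<omega>. ennreal ((y + (real (eps i \<omega> - 1) - 1 + c)) powr q) \<partial>M) \<le> ennreal (y powr q)"
proof -
  define c where "c = (2 - mu) / 2"
  have c: "0 < c" "c \<le> 1" using mu_less_2 mu_ge_1 by (auto simp: c_def)
  define Y where "Y \<omega> = real (eps 1 \<omega> - 1) - 1 + c" for \<omega>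
  have AE: "AE \<omega> in M. Y \<omega> = real (eps 1 \<omega>) - 2 + c"
    using AE_eps_pos[of 1] by eventually_elim (auto simp: Y_def)
  have int: "integrable M (\<lambda>\<omega>. real (eps 1 \<omega> - 1))"
    by (rule integrable_eps[where f = "\<lambda>k. real (k - 1)" and q = 1 and C = 1]) (use p_gt_2 in auto)
  have "\<exists>B\<ge>1. B \<ge> 1 \<and> (\<forall>y\<ge>B. (\<integral>\<^sup>+\<omega>. ennreal ((y + Y \<omega>) powr q) \<partial>M) \<le> ennreal (y powr q))"
  proof (rule negative_drift_powr)
    show Y: "integrable M Y" unfolding Y_def using int by simp
    have "expectation Y = expectation (\<lambda>\<omega>. real (eps 1 \<omega>) - 2 + c)"
      by (rule integral_cong_AE) (use AE Y in auto)
    also have "\<dots> = mu - 2 + c" using integrable_eps_1 by (simp add: expectation_eps prob_space)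
    also have "\<dots> < 0" using mu_less_2 by (simp add: c_def field_simps)
    finally show "expectation Y < 0" .
    show "integrable M (\<lambda>\<omega>. (1 + \<bar>Y \<omega>\<bar>) powr q)" unfolding Y_def
    proof (rule integrable_eps[where f = "\<lambda>k. (1 + \<bar>real (k - 1) - 1 + c\<bar>) powr q" and q = q and C = "3 powr q"])
      fix k :: nat assume "k \<ge> 1"
      then have "1 + \<bar>real (k - 1) - 1 + c\<bar> \<le> 3 * real k" using c by (auto simp: abs_if)
      then have "(1 + \<bar>real (k - 1) - 1 + c\<bar>) powr q \<le> (3 * real k) powr q"
        using q by (intro powr_mono2) auto
      then show "\<bar>(1 + \<bar>real (k - 1) - 1 + c\<bar>) powr q\<bar> \<le> 3 powr q * real k powr q"
        by (simp add: powr_mult)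
    qed (use q in auto)
  qed (use q c in \<open>auto simp: Y_def\<close>)
  then obtain B where B: "1 \<le> B"
    "\<And>y. y \<ge> B \<Longrightarrow> (\<integral>\<^sup>+\<omega>. ennreal ((y + Y \<omega>) powr q) \<partial>M) \<le> ennreal (y powr q)" by blast
  show ?thesis
  proof (rule that[OF c B(1)])
    fix y :: real and i assume "y \<ge> B"
    have "(\<integral>\<^sup>+\<omega>. ennreal ((y + (real (eps i \<omega> - 1) - 1 + c)) powr q) \<partial>M) =
      (\<integral>\<^sup>+\<omega>. ennreal ((y + Y \<omega>) powr q) \<partial>M)"
      unfolding Y_def
      using nn_integral_eps[of "\<lambda>k. ennreal ((y + (real (k - 1) - 1 + c)) powr q)" i]
        nn_integral_eps[of "\<lambda>k. ennreal ((y + (real (k - 1) - 1 + c)) powr q)" 1] by simp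
    also have "\<dots> \<le> ennreal (y powr q)" using B(2)[OF \<open>y \<ge> B\<close>] .
    finally show "(\<integral>\<^sup>+\<omega>. ennreal ((y + (real (eps i \<omega> - 1) - 1 + c)) powr q) \<partial>M) \<le> ennreal (y powr q)" .
  qed
qed

end

lemma add3_powr_le:
  fixes a b c q :: real
  assumes "a \<ge> 0" "b \<ge> 0" "c \<ge> 0" "q \<ge> 0"
  shows "(a + b + c) powr q \<le> 3 powr q * (a powr q + b powr q + c powr q)"
proof -
  define m where "m = max a (max b c)"
  have "(a + b + c) powr q \<le> (3 * m) powr q"
    using assms by (intro powr_mono2) (auto simp: m_def)
  also have "\<dots> = 3 powr q * m powr q" using assms by (simp add: powr_mult m_def)
  also have "m powr q \<le> a powr q + b powr q + c powr q"
    by (auto simp: m_def max_def intro: add_nonneg_nonneg)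
  finally show ?thesis by (simp add: mult_left_mono)
qed

context stationary_coupling
begin

text \<open>The quantity \<open>c * k + W k + W' k + B\<close>, raised to the power \<open>q\<close> and restricted to the event that
the chains have not met and both started from at most \<open>n\<close>, does not
increase in mean. If neither chain is at zero the
sum decreases by 2, otherwise the drift bound applies.\<close>

lemma coupled_moment_step:
  fixes c B q :: real
  assumes cB: "0 < c" "c \<le> 1" "1 \<le> B" "q \<ge> 0"
    and drift: "\<And>y i. y \<ge> B \<Longrightarrow>
      (\<integral>\<^sup>+\<omega>. ennreal ((y + (real (eps i \<omega> - 1) - 1 + c)) powr q) \<partial>M) \<le> ennreal (y powr q)"
  defines "a \<equiv> \<lambda>n k. \<integral>\<^sup>+\<omega>. (if (V \<omega> \<le> n \<and> V' \<omega> \<le> n) \<and> W k \<omega> \<noteq> W' k \<omega>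
      then ennreal ((c * real k + real (W k \<omega>) + real (W' k \<omega>) + B) powr q) else 0) \<partial>M"
  shows "a n (Suc k) \<le> a n k"
proof -
  define X where "X \<omega> = ((V \<omega> \<le> n \<and> V' \<omega> \<le> n), (W k \<omega>, W' k \<omega>))" for \<omega>
  have det: "determined k X" unfolding X_def
    using determined_U[of k "\<lambda>(v, v'). v \<le> n \<and> v' \<le> n"]
    by (intro determined_Pair determined_W determined_W') simp
  define st :: "nat \<Rightarrow> nat \<Rightarrow> nat" where
    "st w e = (w - 1) * of_bool (w \<noteq> 0) + (e - 1) * of_bool (w = 0)" for w e
  define \<Phi> where "\<Phi> x e = (case x of (b, (w, w')) \<Rightarrow> if b \<and> w \<noteq> w'
      then ennreal ((c * real (Suc k) + real (st w e) + real (st w' e) + B) powr q) else 0)"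
    for x :: "bool \<times> nat \<times> nat" and e
  define G where "G x = (case x of (b, (w, w')) \<Rightarrow> if b \<and> w \<noteq> w'
      then ennreal ((c * real k + real w + real w' + B) powr q) else 0)"
    for x :: "bool \<times> nat \<times> nat"
  have "a n (Suc k) \<le> (\<integral>\<^sup>+\<omega>. \<Phi> (X \<omega>) (eps (int (Suc k)) \<omega>) \<partial>M)"
    unfolding a_def by (intro nn_integral_mono) (auto simp: \<Phi>_def X_def st_def)
  also have "\<dots> \<le> (\<integral>\<^sup>+\<omega>. G (X \<omega>) \<partial>M)"
  proof (rule nn_integral_history_step[OF det])
    fix x :: "bool \<times> nat \<times> nat"
    obtain b w w' where x: "x = (b, w, w')" by (cases x) auto
    define y where "y = c * real k + real w + real w' + B"
    have y: "y \<ge> B" using cB by (simp add: y_def)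
    consider "\<not> (b \<and> w \<noteq> w')" | "b" "w = 0" "w' > 0" | "b" "w > 0" "w' = 0"
      | "b" "w \<noteq> w'" "w > 0" "w' > 0" by auto
    then show "(\<integral>\<^sup>+\<omega>. \<Phi> x (eps (int (Suc k)) \<omega>) \<partial>M) \<le> G x"
    proof cases
      case 1
      then show ?thesis by (auto simp: \<Phi>_def G_def x)
    next
      case 2
      then have "c * real (Suc k) + real (st w e) + real (st w' e) + B = y + (real (e - 1) - 1 + c)" for e
        by (simp add: y_def st_def algebra_simps)
      then have "\<Phi> x e = ennreal ((y + (real (e - 1) - 1 + c)) powr q)" for e
        using 2 by (simp only: \<Phi>_def x case_prod_conv) simp
      moreover have "G x = ennreal (y powr q)" using 2 by (simp add: G_def x y_def)
      ultimately show ?thesis using drift[OF y] by simp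
    next
      case 3
      then have "c * real (Suc k) + real (st w e) + real (st w' e) + B = y + (real (e - 1) - 1 + c)" for e
        by (simp add: y_def st_def algebra_simps)
      then have "\<Phi> x e = ennreal ((y + (real (e - 1) - 1 + c)) powr q)" for e
        using 3 by (simp only: \<Phi>_def x case_prod_conv) simp
      moreover have "G x = ennreal (y powr q)" using 3 by (simp add: G_def x y_def)
      ultimately show ?thesis using drift[OF y] by simp
    next
      case 4
      then have "c * real (Suc k) + real (st w e) + real (st w' e) + B = y - 2 + c" for e
        by (simp add: y_def st_def algebra_simps)
      moreover have "(y - 2 + c) powr q \<le> y powr q"
      proof (rule powr_mono2)
        have "0 \<le> c * real k" "1 \<le> real w" "1 \<le> real w'" using cB 4 by auto
        then show "0 \<le> y - 2 + c" using cB unfolding y_def by linarith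
      qed (use cB in auto)
      moreover from calculation have "\<Phi> x e = ennreal ((y - 2 + c) powr q)" for e
        using 4 by (simp only: \<Phi>_def x case_prod_conv) simp
      moreover have "G x = ennreal (y powr q)" using 4 by (simp add: G_def x y_def)
      ultimately show ?thesis by (simp add: emeasure_space_1 ennreal_leI)
    qed
  qed
  also have "(\<integral>\<^sup>+\<omega>. G (X \<omega>) \<partial>M) = a n k"
    by (simp add: a_def G_def X_def)
  finally show ?thesis .
qed

text \<open>The exponent \<open>p - 1/2\<close> lies between \<open>p - 1\<close> and \<open>p\<close>: the innovations have a moment of this order, while
the stationary law does not and must be truncated.\<close>

lemma truncated_moment_le:
  assumes Z: "Z \<in> measurable M (count_space UNIV)" "\<And>j. prob {\<omega> \<in> space M. Z \<omega> = j} = nu j"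
  shows "(\<integral>\<^sup>+\<omega>. (if Z \<omega> \<le> n then ennreal (real (Z \<omega>) powr (p - 1/2)) else 0) \<partial>M)
    \<le> ennreal (2 * real n powr (1/2))"
proof -
  have "(\<integral>\<^sup>+\<omega>. (if Z \<omega> \<le> n then ennreal (real (Z \<omega>) powr (p - 1/2)) else 0) \<partial>M) =
    (\<Sum>k. (if k \<le> n then ennreal (real k powr (p - 1/2)) else 0) * ennreal (nu k))"
    using nn_integral_countable_rv[OF Z(1), of "\<lambda>k. if k \<le> n then ennreal (real k powr (p - 1/2)) else 0"]
    by (simp add: Z(2) nn_integral_count_space_nat)
  also have "\<dots> = (\<Sum>k\<in>{1..n}. (if k \<le> n then ennreal (real k powr (p - 1/2)) else 0) * ennreal (nu k))"
    by (rule suminf_finite) auto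
  also have "\<dots> \<le> (\<Sum>k\<in>{1..n}. ennreal (real k powr - (1/2)))"
  proof (rule sum_mono)
    fix k assume k: "k \<in> {1..n}"
    then have "real k powr (p - 1/2) * nu k \<le> real k powr (p - 1/2) * real k powr - p"
      by (intro mult_left_mono nu_upper) auto
    also have "\<dots> = real k powr - (1/2)" by (simp flip: powr_add)
    finally show "(if k \<le> n then ennreal (real k powr (p - 1/2)) else 0) * ennreal (nu k) \<le> ennreal (real k powr - (1/2))"
      using k by (simp add: ennreal_mult'[symmetric] ennreal_leI)
  qed
  also have "\<dots> = ennreal (\<Sum>k\<in>{1..n}. real k powr - (1/2))" by (rule sum_ennreal) auto
  also have "\<dots> \<le> ennreal (2 * real n powr (1/2))" by (intro ennreal_leI sum_inverse_sqrt_le)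
  finally show ?thesis .
qed

lemma start_tail_le:
  assumes Z: "Z \<in> measurable M (count_space UNIV)" "\<And>j. prob {\<omega> \<in> space M. Z \<omega> = j} = nu j" and n: "n \<ge> 1"
  shows "prob {\<omega> \<in> space M. Z \<omega> > n} \<le> real n powr (1 - p)"
proof -
  have sums: "(\<lambda>i. nu (n + 1 + i)) sums prob {\<omega> \<in> space M. Z \<omega> > n}"
    using nat_rv_tail_sums[OF Z(1), of "n + 1"] by (simp add: Z(2) Suc_le_eq)
  then have "prob {\<omega> \<in> space M. Z \<omega> > n} = (\<Sum>i. nu (n + 1 + i))" by (simp add: sums_iff)
  also have "\<dots> \<le> (\<Sum>i. real (n + 1 + i) powr - p)"
    using sums summable_shifted_powr[of p "n + 1"] p_gt_2
    by (intro suminf_le nu_upper) (auto simp: sums_iff)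
  also have "\<dots> \<le> real n powr (1 - p) / (p - 1)"
    using p_gt_2 n by (intro powr_tail_upper) auto
  also have "\<dots> \<le> real n powr (1 - p)"
    using frac_le[of "real n powr (1 - p)" "real n powr (1 - p)" 1 "p - 1"] p_gt_2 by simp
  finally show ?thesis .
qed

text \<open>Initial states above \<open>n\<close> account for \<open>n powr (1 - p)\<close>. For the others, \<open>(c * n) powr q\<close> times the
probability of not having met at time \<open>n\<close> is at most the initial truncated moment of order
\<open>q = p - 1/2\<close>, which is of order \<open>sqrt n\<close>.\<close>

lemma prob_meeting_upper:
  obtains C where "C \<ge> 0"
    "\<And>n. n \<ge> 1 \<Longrightarrow> prob {\<omega> \<in> space M. meeting_time W W' \<omega> \<ge> enat (n + 1)} \<le> C * real n powr (1 - p)"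
proof -
  define q where "q = p - 1/2"
  have q: "1 \<le> q" "q < p" using p_gt_2 by (auto simp: q_def)
  from step_drift[OF q] obtain c B where cB: "0 < c" "c \<le> 1" "1 \<le> B" and
    drift: "\<And>y i. y \<ge> B \<Longrightarrow>
      (\<integral>\<^sup>+\<omega>. ennreal ((y + (real (eps i \<omega> - 1) - 1 + c)) powr q) \<partial>M) \<le> ennreal (y powr q)" by metis
  define a where "a n k = (\<integral>\<^sup>+\<omega>. (if (V \<omega> \<le> n \<and> V' \<omega> \<le> n) \<and> W k \<omega> \<noteq> W' k \<omega>
      then ennreal ((c * real k + real (W k \<omega>) + real (W' k \<omega>) + B) powr q) else 0) \<partial>M)" for n k
  have "a n (Suc k) \<le> a n k" for n k
    unfolding a_def using cB q drift by (intro coupled_moment_step) auto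
  then have mono: "a n k \<le> a n 0" for n k by (induction k) (auto intro: order_trans)
  define K where "K = 3 powr q * (4 + B powr q)"
  have a0: "a n 0 \<le> ennreal (K * real n powr (1/2))" if n: "n \<ge> 1" for n
  proof -
    let ?f = "\<lambda>Z \<omega>. if Z \<omega> \<le> n then ennreal (real (Z \<omega>) powr q) else 0"
    have meas: "?f Z \<in> borel_measurable M" if "Z \<in> measurable M (count_space UNIV)" for Z
      by (rule measurable_compose[OF that, of "\<lambda>z. if z \<le> n then ennreal (real z powr q) else 0"]) auto
    have "a n 0 \<le> (\<integral>\<^sup>+\<omega>. ennreal (3 powr q) * (?f V \<omega> + ?f V' \<omega> + ennreal (B powr q)) \<partial>M)"
      unfolding a_def
    proof (rule nn_integral_mono)
      fix \<omega>
      have "(real (V \<omega>) + real (V' \<omega>) + B) powr q \<le> 3 powr q * (real (V \<omega>) powr q + real (V' \<omega>) powr q + B powr q)"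
        using cB q by (intro add3_powr_le) auto
      then have "ennreal ((real (V \<omega>) + real (V' \<omega>) + B) powr q) \<le>
        ennreal (3 powr q) * (ennreal (real (V \<omega>) powr q) + ennreal (real (V' \<omega>) powr q) + ennreal (B powr q))"
        by (simp add: ennreal_mult'[symmetric] ennreal_leI flip: ennreal_plus)
      then show "(if (V \<omega> \<le> n \<and> V' \<omega> \<le> n) \<and> W 0 \<omega> \<noteq> W' 0 \<omega>
          then ennreal ((c * real 0 + real (W 0 \<omega>) + real (W' 0 \<omega>) + B) powr q) else 0)
        \<le> ennreal (3 powr q) * (?f V \<omega> + ?f V' \<omega> + ennreal (B powr q))" by simp
    qed
    also have "\<dots> = ennreal (3 powr q) * ((\<integral>\<^sup>+\<omega>. ?f V \<omega> \<partial>M) + (\<integral>\<^sup>+\<omega>. ?f V' \<omega> \<partial>M) + ennreal (B powr q))"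
      using meas[OF measurable_V] meas[OF measurable_V']
      by (simp add: nn_integral_cmult nn_integral_add emeasure_space_1)
    also have "\<dots> \<le> ennreal (3 powr q) * (ennreal (2 * real n powr (1/2)) + ennreal (2 * real n powr (1/2)) + ennreal (B powr q))"
      unfolding q_def
      by (intro mult_left_mono add_mono truncated_moment_le measurable_V measurable_V' prob_V prob_V' order_refl) auto
    also have "\<dots> = ennreal (3 powr q * (4 * real n powr (1/2) + B powr q))"
      by (simp add: ennreal_mult'[symmetric] flip: ennreal_plus)
    also have "\<dots> \<le> ennreal (K * real n powr (1/2))"
    proof (rule ennreal_leI)
      have "1 \<le> real n powr (1/2)" using n by (intro ge_one_powr_ge_zero) auto
      then have "B powr q * 1 \<le> B powr q * real n powr (1/2)" by (intro mult_left_mono) auto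
      then have "4 * real n powr (1/2) + B powr q \<le> (4 + B powr q) * real n powr (1/2)"
        by (simp add: algebra_simps)
      then show "3 powr q * (4 * real n powr (1/2) + B powr q) \<le> K * real n powr (1/2)"
        unfolding K_def mult.assoc by (intro mult_left_mono) auto
    qed
    finally show ?thesis .
  qed
  have S: "{\<omega> \<in> space M. (V \<omega> \<le> n \<and> V' \<omega> \<le> n) \<and> W n \<omega> \<noteq> W' n \<omega>} \<in> events" for n
    using determined_comp2[OF determined_U[of n "\<lambda>(v, v'). v \<le> n \<and> v' \<le> n"]
        determined_comp2[OF determined_W determined_W', of n "(\<noteq>)"], of "(\<and>)"]
    by (intro determined_event) simp
  have bulk: "prob {\<omega> \<in> space M. (V \<omega> \<le> n \<and> V' \<omega> \<le> n) \<and> W n \<omega> \<noteq> W' n \<omega>} \<le> K / c powr q * real n powr (1 - p)"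
    if n: "n \<ge> 1" for n
  proof -
    let ?S = "{\<omega> \<in> space M. (V \<omega> \<le> n \<and> V' \<omega> \<le> n) \<and> W n \<omega> \<noteq> W' n \<omega>}"
    have "ennreal ((c * real n) powr q * prob ?S) = (\<integral>\<^sup>+\<omega>. ennreal ((c * real n) powr q) * indicator ?S \<omega> \<partial>M)"
      using S by (subst nn_integral_cmult_indicator) (auto simp: emeasure_eq_measure ennreal_mult')
    also have "\<dots> \<le> a n n" unfolding a_def
    proof (rule nn_integral_mono)
      fix \<omega>
      have "(c * real n) powr q \<le> (c * real n + real (W n \<omega>) + real (W' n \<omega>) + B) powr q"
        using cB q by (intro powr_mono2) auto
      then show "ennreal ((c * real n) powr q) * indicator ?S \<omega> \<le>
        (if (V \<omega> \<le> n \<and> V' \<omega> \<le> n) \<and> W n \<omega> \<noteq> W' n \<omega>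
         then ennreal ((c * real n + real (W n \<omega>) + real (W' n \<omega>) + B) powr q) else 0)"
        by (auto simp: indicator_def intro!: ennreal_leI)
    qed
    also have "\<dots> \<le> ennreal (K * real n powr (1/2))" using mono a0[OF n] by (rule order_trans)
    finally have "(c * real n) powr q * prob ?S \<le> K * real n powr (1/2)"
      by (subst (asm) ennreal_le_iff) (auto simp: K_def)
    then have "prob ?S \<le> K * real n powr (1/2) / (c * real n) powr q"
      using cB n by (simp add: field_simps)
    also have "\<dots> = K / c powr q * (real n powr (1/2) / real n powr q)"
      using cB n by (simp add: powr_mult)
    also have "real n powr (1/2) / real n powr q = real n powr (1 - p)"
      unfolding q_def by (simp flip: powr_diff)
    finally show ?thesis .
  qed
  show ?thesis
  proof (rule that)
    show "2 + K / c powr q \<ge> 0" by (simp add: K_def)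
    fix n :: nat assume n: "n \<ge> 1"
    let ?S = "{\<omega> \<in> space M. (V \<omega> \<le> n \<and> V' \<omega> \<le> n) \<and> W n \<omega> \<noteq> W' n \<omega>}"
    let ?A = "\<lambda>Z. {\<omega> \<in> space M. Z \<omega> > n}"
    have A: "?A V \<in> events" "?A V' \<in> events" by measurable
    have "prob {\<omega> \<in> space M. meeting_time W W' \<omega> \<ge> enat (n + 1)} \<le> prob ((?A V \<union> ?A V') \<union> ?S)"
    proof (rule finite_measure_mono)
      show "{\<omega> \<in> space M. meeting_time W W' \<omega> \<ge> enat (n + 1)} \<subseteq> (?A V \<union> ?A V') \<union> ?S"
        unfolding meeting_time_ge_iff by force
      show "(?A V \<union> ?A V') \<union> ?S \<in> events" using A S by (intro sets.Un)
    qed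
    also have "\<dots> \<le> prob (?A V \<union> ?A V') + prob ?S" using A S by (intro measure_Un_le) auto
    also have "prob (?A V \<union> ?A V') \<le> prob (?A V) + prob (?A V')" using A by (intro measure_Un_le) auto
    also have "prob (?A V) \<le> real n powr (1 - p)" by (rule start_tail_le[OF measurable_V prob_V n])
    also have "prob (?A V') \<le> real n powr (1 - p)" by (rule start_tail_le[OF measurable_V' prob_V' n])
    also note bulk[OF n]
    finally show "prob {\<omega> \<in> space M. meeting_time W W' \<omega> \<ge> enat (n + 1)} \<le> (2 + K / c powr q) * real n powr (1 - p)"
      by (simp add: algebra_simps)
  qed
qed

lemma meeting_series_converges:
  assumes e: "e > 0"
  shows "(\<Sum>n. ennreal (real (n + 2) powr (p - 2) * ln (real (n + 2)) powr - (1 + e) *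
     prob {\<omega> \<in> space M. meeting_time W W' \<omega> \<ge> enat (n + 2)})) < \<infinity>"
proof -
  obtain C where C: "C \<ge> 0"
    "\<And>n. n \<ge> 1 \<Longrightarrow> prob {\<omega> \<in> space M. meeting_time W W' \<omega> \<ge> enat (n + 1)} \<le> C * real n powr (1 - p)"
    using prob_meeting_upper by metis
  define D where "D = 2 powr (p - 2) * 3 powr (1 + e) * C"
  define b where "b n = 1 / (real n * (1 + ln (real n)) powr (1 + e))" for n
  have "summable b" unfolding b_def using summable_bertrand_iff[of "1 + e"] e by simp
  then have sm: "summable (\<lambda>n. D * b (Suc n))" by (intro summable_mult) (simp add: summable_Suc_iff)
  have "(\<Sum>n. ennreal (real (n + 2) powr (p - 2) * ln (real (n + 2)) powr - (1 + e) *
     prob {\<omega> \<in> space M. meeting_time W W' \<omega> \<ge> enat (n + 2)})) \<le> (\<Sum>n. ennreal (D * b (Suc n)))"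
  proof (intro suminf_le ennreal_leI)
    fix n
    define m where "m = Suc n"
    have m: "m \<ge> 1" "n + 2 = m + 1" by (auto simp: m_def)
    have "real (m + 1) powr (p - 2) \<le> (2 * real m) powr (p - 2)"
      using m p_gt_2 by (intro powr_mono2) auto
    then have 1: "real (m + 1) powr (p - 2) \<le> 2 powr (p - 2) * real m powr (p - 2)"
      by (simp add: powr_mult)
    define x y where "x = ln (real m)" and "y = ln (real (m + 1))"
    have "ln 2 \<le> y" "x \<le> y" "x \<ge> 0" using m by (auto simp: x_def y_def)
    then have "(1 + x) / 3 \<le> y" "0 < 1 + x" using ln2_ge_two_thirds by auto
    then have l: "(1 + ln (real m)) / 3 \<le> ln (real (m + 1))" "0 < 1 + ln (real m)"
      by (simp_all only: x_def y_def)
    then have "ln (real (m + 1)) powr - (1 + e) \<le> ((1 + ln (real m)) / 3) powr - (1 + e)"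
      using e by (intro powr_mono2') auto
    also have "\<dots> = 3 powr (1 + e) * (1 + ln (real m)) powr - (1 + e)"
    proof -
      have "(z / 3) powr - s = 3 powr s * z powr - s" if "z > 0" for z s :: real
        using that by (simp add: powr_divide powr_minus field_simps)
      then show ?thesis using l(2) by blast
    qed
    finally have 2: "ln (real (m + 1)) powr - (1 + e) \<le> 3 powr (1 + e) * (1 + ln (real m)) powr - (1 + e)" .
    have "real (m + 1) powr (p - 2) * ln (real (m + 1)) powr - (1 + e) *
        prob {\<omega> \<in> space M. meeting_time W W' \<omega> \<ge> enat (m + 1)}
      \<le> (2 powr (p - 2) * real m powr (p - 2)) * (3 powr (1 + e) * (1 + ln (real m)) powr - (1 + e)) *
        (C * real m powr (1 - p))"
      using 1 2 C(2)[OF m(1)] by (intro mult_mono) auto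
    also have "\<dots> = D * (real m powr (p - 2 + (1 - p)) * (1 + ln (real m)) powr - (1 + e))"
      unfolding D_def powr_add by simp
    also have "p - 2 + (1 - p) = - 1" by simp
    also have "D * (real m powr - 1 * (1 + ln (real m)) powr - (1 + e)) = D * b m"
      unfolding b_def powr_minus_divide using m by simp
    finally show "real (n + 2) powr (p - 2) * ln (real (n + 2)) powr - (1 + e) *
        prob {\<omega> \<in> space M. meeting_time W W' \<omega> \<ge> enat (n + 2)} \<le> D * b (Suc n)"
      unfolding m(2) by (simp only: m_def)
  qed auto
  also have "\<dots> = ennreal (\<Sum>n. D * b (Suc n))"
    using sm C(1) by (intro suminf_ennreal2) (auto simp: D_def b_def)
  also have "\<dots> < \<infinity>" by simp
  finally show ?thesis .
qed

end

section \<open>Long jumps from zero\<close>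

text \<open>A single chain, whose initial state is independent of the innovations and has an arbitrary law.\<close>

locale started_chain = zeta_innovations M p eps
  for M :: "'a measure" and p eps +
  fixes V :: "'a \<Rightarrow> nat"
  assumes indep_V: "indep_of_innovations M eps V"
begin

lemma indep_set_V:
  "indep_set (generated M (count_space UNIV) V) (generated M path_space (\<lambda>\<omega> i. eps i \<omega>))"
  using indep_V by (simp add: indep_of_innovations_def)

sublocale started_innovations M p eps V
proof
  have "{\<omega> \<in> space M. V \<omega> = j} \<in> events" for j
    using level_generated[of V j] indep_setD_ev1[OF indep_set_V] by auto
  moreover have "V -` {j} \<inter> space M = {\<omega> \<in> space M. V \<omega> = j}" for j by auto
  ultimately show "V \<in> measurable M (count_space UNIV)"
    by (auto simp: measurable_count_space_eq2_countable)
next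
  fix u A assume "A \<in> generated M path_space (\<lambda>\<omega> i. eps i \<omega>)"
  then show "prob ({\<omega> \<in> space M. V \<omega> = u} \<inter> A) = prob {\<omega> \<in> space M. V \<omega> = u} * prob A"
    by (intro indep_setD[OF indep_set_V] level_generated)
qed

abbreviation W :: "nat \<Rightarrow> 'a \<Rightarrow> nat" where "W \<equiv> chain V eps"

lemma determined_W: "determined k (W k)"
  using determined_chain[of k "\<lambda>x. x"] by simp

text \<open>The variable \<open>\<xi> (eps i)\<close> is centred, with a second moment of the order of the probability \<open>q\<close> of a
jump above \<open>t\<close>. When no such jump occurs its first term vanishes, which leaves the second one, a
multiple of the innovation.\<close>

lemma centred_step_second_moment:
  fixes q :: real and t :: nat
  defines "q \<equiv> prob {\<omega> \<in> space M. eps 1 \<omega> > t}"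
  defines "\<xi> \<equiv> \<lambda>e. mu * of_bool (e > t) - q * real e"
  shows "(\<integral>\<^sup>+\<omega>. ennreal ((x + \<xi> (eps i \<omega>))\<^sup>2) \<partial>M) \<le>
    ennreal (x\<^sup>2 + (2 * mu\<^sup>2 + 2 * expectation (\<lambda>\<omega>. (real (eps 1 \<omega>))\<^sup>2)) * q)"
proof -
  define s2 where "s2 = expectation (\<lambda>\<omega>. (real (eps 1 \<omega>))\<^sup>2)"
  have q: "0 \<le> q" "q \<le> 1" by (auto simp: q_def)
  have q_eq: "expectation (\<lambda>\<omega>. of_bool (eps i \<omega> > t) :: real) = q"
  proof -
    have "expectation (\<lambda>\<omega>. of_bool (eps i \<omega> > t) :: real) = expectation (\<lambda>\<omega>. of_bool (eps 1 \<omega> > t))"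
      using expectation_eps_cong[of "\<lambda>e. of_bool (e > t)"] .
    also have "\<dots> = expectation (indicator {\<omega> \<in> space M. eps 1 \<omega> > t})"
      by (rule Bochner_Integration.integral_cong) (auto simp: indicator_def)
    also have "\<dots> = q" by (simp add: q_def)
    finally show ?thesis .
  qed
  have s2_eq: "expectation (\<lambda>\<omega>. (real (eps i \<omega>))\<^sup>2) = s2"
    unfolding s2_def using expectation_eps_cong[of "\<lambda>e. (real e)\<^sup>2"] .
  have i0: "integrable M (\<lambda>\<omega>. of_bool (eps i \<omega> > t) :: real)"
    by (rule integrable_eps[where f = "\<lambda>e. of_bool (e > t)" and q = 0 and C = 1]) (use p_gt_2 in auto)
  note int = i0 integrable_eps_1[of i] integrable_eps_2[of i]
  have i1: "integrable M (\<lambda>\<omega>. \<xi> (eps i \<omega>))" using int by (simp add: \<xi>_def)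
  have pw: "(\<xi> e)\<^sup>2 \<le> 2 * mu\<^sup>2 * of_bool (e > t) + 2 * q\<^sup>2 * (real e)\<^sup>2" for e
  proof -
    have "(a - b)\<^sup>2 \<le> 2 * a\<^sup>2 + 2 * b\<^sup>2" for a b :: real
      using zero_le_power2[of "a + b"] by (simp add: power2_eq_square algebra_simps)
    from this[of "mu * of_bool (e > t)" "q * real e"] show ?thesis
      by (auto simp: \<xi>_def power_mult_distrib)
  qed
  have i2: "integrable M (\<lambda>\<omega>. (\<xi> (eps i \<omega>))\<^sup>2)"
  proof (rule Bochner_Integration.integrable_bound)
    show "integrable M (\<lambda>\<omega>. 2 * mu\<^sup>2 * of_bool (eps i \<omega> > t) + 2 * q\<^sup>2 * (real (eps i \<omega>))\<^sup>2)"
      using int by simp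
    show "(\<lambda>\<omega>. (\<xi> (eps i \<omega>))\<^sup>2) \<in> borel_measurable M" using i1 by measurable
    show "AE \<omega> in M. norm ((\<xi> (eps i \<omega>))\<^sup>2) \<le> norm (2 * mu\<^sup>2 * of_bool (eps i \<omega> > t) + 2 * q\<^sup>2 * (real (eps i \<omega>))\<^sup>2)"
      using pw by (intro AE_I2) (simp add: order_trans[OF _ abs_ge_self])
  qed
  have "expectation (\<lambda>\<omega>. \<xi> (eps i \<omega>)) = mu * q - q * mu"
    unfolding \<xi>_def using int by (simp add: q_eq expectation_eps)
  then have e1: "expectation (\<lambda>\<omega>. \<xi> (eps i \<omega>)) = 0" by simp
  have "expectation (\<lambda>\<omega>. (\<xi> (eps i \<omega>))\<^sup>2) \<le>
    expectation (\<lambda>\<omega>. 2 * mu\<^sup>2 * of_bool (eps i \<omega> > t) + 2 * q\<^sup>2 * (real (eps i \<omega>))\<^sup>2)"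
    using int by (intro integral_mono i2 pw) simp
  also have "\<dots> = 2 * mu\<^sup>2 * q + 2 * q\<^sup>2 * s2"
    using int by (simp add: q_eq s2_eq)
  also have "\<dots> \<le> 2 * mu\<^sup>2 * q + 2 * q * s2"
  proof -
    have "s2 \<ge> 0" unfolding s2_def by (rule Bochner_Integration.integral_nonneg) simp
    moreover have "q\<^sup>2 \<le> q" using q by (simp add: power2_eq_square mult_left_le)
    ultimately show ?thesis by (simp add: mult_right_mono)
  qed
  finally have e2: "expectation (\<lambda>\<omega>. (\<xi> (eps i \<omega>))\<^sup>2) \<le> (2 * mu\<^sup>2 + 2 * s2) * q"
    by (simp add: algebra_simps)
  have sq: "(x + \<xi> (eps i \<omega>))\<^sup>2 = x\<^sup>2 + 2 * x * \<xi> (eps i \<omega>) + (\<xi> (eps i \<omega>))\<^sup>2" for \<omega>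
    by (rule power2_sum[THEN trans]) simp
  have "integrable M (\<lambda>\<omega>. (x + \<xi> (eps i \<omega>))\<^sup>2)" unfolding sq using i1 i2 by simp
  then have "(\<integral>\<^sup>+\<omega>. ennreal ((x + \<xi> (eps i \<omega>))\<^sup>2) \<partial>M) = ennreal (expectation (\<lambda>\<omega>. (x + \<xi> (eps i \<omega>))\<^sup>2))"
    by (intro nn_integral_eq_integral) auto
  also have "expectation (\<lambda>\<omega>. (x + \<xi> (eps i \<omega>))\<^sup>2) = x\<^sup>2 + expectation (\<lambda>\<omega>. (\<xi> (eps i \<omega>))\<^sup>2)"
    unfolding sq using i1 i2 by (simp add: e1 prob_space)
  also have "ennreal \<dots> \<le> ennreal (x\<^sup>2 + (2 * mu\<^sup>2 + 2 * s2) * q)"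
    using e2 by (intro ennreal_leI) simp
  finally show ?thesis by (simp only: s2_def)
qed

text \<open>As the innovations are positive, at a zero of the chain the next one equals
\<open>W (Suc j) - W j + 1\<close>, and elsewhere that expression vanishes. Summation by parts with decreasing weights \<open>q\<close> then bounds the weighted sum of the
innovations used at zeros without any ergodic theorem.\<close>

lemma chain_abel_lower:
  fixes q :: "nat \<Rightarrow> real"
  assumes q: "decseq q" "\<And>j. 0 \<le> q j" "\<And>j. q j \<le> 1"
    and e: "\<And>i. eps i \<omega> \<ge> 1" and mn: "m \<le> n"
  shows "(\<Sum>j = m..<n. q j) - real (W m \<omega>) \<le>
    (\<Sum>j = m..<n. q j * real (eps (int (Suc j)) \<omega>) * of_bool (W j \<omega> = 0))"
proof -
  have "q n * real (W n \<omega>) - q m * real (W m \<omega>) + (\<Sum>j = m..<n. q j) \<le>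
    (\<Sum>j = m..<n. q j * real (eps (int (Suc j)) \<omega>) * of_bool (W j \<omega> = 0))"
    using mn
  proof (induction n rule: dec_induct)
    case (step n)
    have "real (eps (int (Suc n)) \<omega>) * of_bool (W n \<omega> = 0) = real (W (Suc n) \<omega>) - real (W n \<omega>) + 1"
      using e[of "int (Suc n)"] by (auto simp: of_nat_diff)
    then have "q n * real (eps (int (Suc n)) \<omega>) * of_bool (W n \<omega> = 0) =
        q n * (real (W (Suc n) \<omega>) - real (W n \<omega>) + 1)"
      by (simp only: mult.assoc)
    then have "q n * real (eps (int (Suc n)) \<omega>) * of_bool (W n \<omega> = 0) =
        q n * real (W (Suc n) \<omega>) - q n * real (W n \<omega>) + q n"
      by (simp only: distrib_left right_diff_distrib mult_1_right)
    moreover have "q (Suc n) * real (W (Suc n) \<omega>) \<le> q n * real (W (Suc n) \<omega>)"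
      using q(1) by (intro mult_right_mono) (auto simp: decseq_Suc_iff)
    ultimately show ?case using step by simp
  qed simp
  moreover have "q m * real (W m \<omega>) \<le> 1 * real (W m \<omega>)" using q by (intro mult_right_mono) auto
  moreover have "0 \<le> q n * real (W n \<omega>)" using q by simp
  ultimately show ?thesis by linarith
qed

text \<open>A Borel-Cantelli lemma for the jumps that the chain really makes. If none of them exceeds its
threshold at the times from \<open>m\<close> to \<open>n - 1\<close>, the martingale with increments
\<open>of_bool (W j = 0) * \<xi> j (eps (Suc j))\<close> lies below \<open>- (s - W m)\<close>, where \<open>s\<close> is the sum of the tail
probabilities, whereas its variance is only of order \<open>s\<close>.\<close>

lemma long_jumps_from_zero_infinitely_often:
  fixes t :: "nat \<Rightarrow> nat"
  assumes t: "mono t"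
    and div: "\<not> summable (\<lambda>j. prob {\<omega> \<in> space M. eps 1 \<omega> > t j})"
  shows "AE \<omega> in M. \<exists>\<^sub>\<infinity>j. W j \<omega> = 0 \<and> eps (int (Suc j)) \<omega> > t j"
proof -
  define q where "q j = prob {\<omega> \<in> space M. eps 1 \<omega> > t j}" for j
  define K where "K = 2 * mu\<^sup>2 + 2 * expectation (\<lambda>\<omega>. (real (eps 1 \<omega>))\<^sup>2)"
  have K: "K \<ge> 0" unfolding K_def by simp
  have q: "0 \<le> q j" "q j \<le> 1" for j by (auto simp: q_def)
  have qd: "decseq q" unfolding decseq_def q_def
    using t by (auto intro!: finite_measure_mono simp: mono_def intro: le_less_trans)
  define A where "A j \<omega> \<longleftrightarrow> W j \<omega> = 0 \<and> eps (int (Suc j)) \<omega> > t j" for j \<omega>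
  have detA: "determined (Suc j) (A j)" for j
    unfolding A_def
    using determined_comp2[OF determined_Suc[OF determined_W] determined_eps,
        of j "\<lambda>w e. w = 0 \<and> e > t j"] by simp
  define \<xi> where "\<xi> j e = mu * of_bool (e > t j) - q j * real e" for j and e :: nat
  define S where "S m n \<omega> = (\<Sum>j = m..<n. of_bool (W j \<omega> = 0) * \<xi> j (eps (int (Suc j)) \<omega>))" for m n \<omega>
  have detS: "determined n (S m n)" for m n
  proof (induction n)
    case 0
    show ?case using determined_U[of 0 "\<lambda>_. 0 :: real"] by (simp add: S_def[abs_def])
  next
    case (Suc n)
    have *: "determined (Suc n) (\<lambda>\<omega>. of_bool (W n \<omega> = 0) * \<xi> n (eps (int (Suc n)) \<omega>))"
      using determined_comp2[OF determined_Suc[OF determined_W] determined_eps,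
          of n "\<lambda>w e. of_bool (w = 0) * \<xi> n e"] by simp
    show ?case
    proof (cases "m \<le> n")
      case True
      then have "S m (Suc n) = (\<lambda>\<omega>. S m n \<omega> + of_bool (W n \<omega> = 0) * \<xi> n (eps (int (Suc n)) \<omega>))"
        by (simp add: S_def fun_eq_iff)
      then show ?thesis using determined_comp2[OF determined_Suc[OF Suc] *, of "(+)"] by simp
    next
      case False
      then show ?thesis using determined_U[of "Suc n" "\<lambda>_. 0 :: real"] by (simp add: S_def[abs_def])
    qed
  qed
  have S2: "(\<integral>\<^sup>+\<omega>. ennreal ((S m n \<omega>)\<^sup>2) \<partial>M) \<le> ennreal (K * (\<Sum>j = m..<n. q j))" if "m \<le> n" for m n
    using that
  proof (induction n rule: dec_induct)
    case base
    show ?case by (simp add: S_def)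
  next
    case (step n)
    define \<Phi> where "\<Phi> x e = ennreal ((fst x + of_bool (snd x = 0) * \<xi> n e)\<^sup>2)" for x :: "real \<times> nat" and e
    have "(\<integral>\<^sup>+\<omega>. ennreal ((S m (Suc n) \<omega>)\<^sup>2) \<partial>M) = (\<integral>\<^sup>+\<omega>. \<Phi> (S m n \<omega>, W n \<omega>) (eps (int (Suc n)) \<omega>) \<partial>M)"
      using step(1) by (simp add: S_def \<Phi>_def)
    also have "\<dots> \<le> (\<integral>\<^sup>+\<omega>. (\<lambda>x. ennreal ((fst x)\<^sup>2 + K * q n)) (S m n \<omega>, W n \<omega>) \<partial>M)"
    proof (rule nn_integral_history_step[OF determined_Pair[OF detS determined_W]])
      fix x :: "real \<times> nat"
      show "(\<integral>\<^sup>+\<omega>. \<Phi> x (eps (int (Suc n)) \<omega>) \<partial>M) \<le> ennreal ((fst x)\<^sup>2 + K * q n)"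
      proof (cases "snd x = 0")
        case True
        then show ?thesis
          using centred_step_second_moment[of "fst x" "t n" "int (Suc n)"]
          by (simp add: \<Phi>_def \<xi>_def q_def K_def)
      next
        case False
        then show ?thesis using K q by (simp add: \<Phi>_def emeasure_space_1 ennreal_leI)
      qed
    qed
    also have "\<dots> = (\<integral>\<^sup>+\<omega>. ennreal ((S m n \<omega>)\<^sup>2) + ennreal (K * q n) \<partial>M)"
      using K q by (intro nn_integral_cong) simp
    also have "\<dots> = (\<integral>\<^sup>+\<omega>. ennreal ((S m n \<omega>)\<^sup>2) \<partial>M) + ennreal (K * q n)"
    proof -
      have "(\<lambda>\<omega>. ennreal ((S m n \<omega>)\<^sup>2)) \<in> borel_measurable M"
        using measurable_compose[OF measurable_determined[OF detS, of "\<lambda>x. x" m n], of "\<lambda>x. ennreal (x\<^sup>2)" borel] by simp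
      then show ?thesis by (subst nn_integral_add) (auto simp: emeasure_space_1)
    qed
    also have "\<dots> \<le> ennreal (K * (\<Sum>j = m..<n. q j)) + ennreal (K * q n)"
      using step by (intro add_right_mono) auto
    also have "\<dots> = ennreal (K * (\<Sum>j = m..<Suc n. q j))"
      using K q step(1) by (simp add: algebra_simps sum_nonneg flip: ennreal_plus)
    finally show ?case .
  qed
  have e1: "AE \<omega> in M. \<forall>i. eps i \<omega> \<ge> 1" using AE_eps_pos by (simp add: AE_all_countable)
  define N where "N m = {\<omega> \<in> space M. \<forall>j. j \<ge> m \<longrightarrow> \<not> A j \<omega>}" for m
  have NE: "N m \<in> events" for m
    unfolding N_def by (intro sets.sets_Collect_countable_All determined_event[OF determined_comp[OF detA, of j "\<lambda>b. j \<ge> m \<longrightarrow> \<not> b" for j]])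
  define T where "T m r = {\<omega> \<in> space M. r \<le> W m \<omega>}" for m r
  have TE: "T m r \<in> events" for m r
    unfolding T_def by (rule determined_event[OF determined_comp[OF determined_W]])
  have bound: "prob (N m) \<le> prob (T m r) + 2 * (K / real r)" if r: "r \<ge> 1" for m r
  proof -
    have "\<exists>n\<ge>m. 2 * real r \<le> (\<Sum>j = m..<n. q j)"
    proof (rule ccontr)
      assume *: "\<not> ?thesis"
      have "summable (\<lambda>j. q (j + m))"
      proof (rule bounded_imp_summable)
        fix n
        have "(\<Sum>j\<le>n. q (j + m)) = (\<Sum>j = m..<m + Suc n. q j)"
          using sum.shift_bounds_nat_ivl[of q 0 m "Suc n"]
          by (simp add: atLeast0LessThan lessThan_Suc_atMost add.commute)
        also have "\<dots> \<le> 2 * real r" using * by (metis le_add1 linear)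
        finally show "(\<Sum>j\<le>n. q (j + m)) \<le> 2 * real r" .
      qed (rule q)
      then show False using div summable_iff_shift[of q m] by (simp add: q_def[abs_def])
    qed
    \<comment> \<open>Chebyshev's inequality is applied at a time when the tail probabilities sum to at least \<open>2 * r\<close>.\<close>
    obtain n where n: "m \<le> n" "2 * real r \<le> (\<Sum>j = m..<n. q j)" using \<open>\<exists>n\<ge>m. _\<close> by blast
    define s where "s = (\<Sum>j = m..<n. q j)"
    have s: "2 * real r \<le> s" "s > 0" using n r by (auto simp: s_def)
    have D: "N m - T m r \<in> events" using NE TE by auto
    have "ennreal ((s / 2)\<^sup>2 * prob (N m - T m r)) = (\<integral>\<^sup>+\<omega>. ennreal ((s / 2)\<^sup>2) * indicator (N m - T m r) \<omega> \<partial>M)"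
      using D by (subst nn_integral_cmult_indicator) (auto simp: emeasure_eq_measure ennreal_mult')
    also have "\<dots> \<le> (\<integral>\<^sup>+\<omega>. ennreal ((S m n \<omega>)\<^sup>2) \<partial>M)"
    proof (rule nn_integral_mono_AE)
      show "AE \<omega> in M. ennreal ((s / 2)\<^sup>2) * indicator (N m - T m r) \<omega> \<le> ennreal ((S m n \<omega>)\<^sup>2)"
        using e1
      proof eventually_elim
        fix \<omega> assume e: "\<forall>i. eps i \<omega> \<ge> 1"
        show "ennreal ((s / 2)\<^sup>2) * indicator (N m - T m r) \<omega> \<le> ennreal ((S m n \<omega>)\<^sup>2)"
        proof (cases "\<omega> \<in> N m - T m r")
          case True
          then have \<omega>: "\<And>j. j \<ge> m \<Longrightarrow> \<not> A j \<omega>" "real (W m \<omega>) < real r" by (auto simp: N_def T_def)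
          have "S m n \<omega> = - (\<Sum>j = m..<n. q j * real (eps (int (Suc j)) \<omega>) * of_bool (W j \<omega> = 0))"
            unfolding S_def sum_negf[symmetric]
          proof (rule sum.cong[OF refl])
            fix j assume "j \<in> {m..<n}"
            then show "of_bool (W j \<omega> = 0) * \<xi> j (eps (int (Suc j)) \<omega>) =
              - (q j * real (eps (int (Suc j)) \<omega>) * of_bool (W j \<omega> = 0))"
              using \<omega>(1)[of j] by (auto simp: A_def \<xi>_def)
          qed
          also have "\<dots> \<le> - (s - real (W m \<omega>))"
            using chain_abel_lower[OF qd q _ n(1), of \<omega>] e by (simp add: s_def)
          finally have "s / 2 \<le> - S m n \<omega>" using \<omega>(2) s by simp
          then have "(s / 2)\<^sup>2 \<le> (- S m n \<omega>)\<^sup>2" using s by (intro power_mono) auto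
          then show ?thesis using True by (simp add: ennreal_leI)
        qed simp
      qed
    qed
    also have "\<dots> \<le> ennreal (K * s)" unfolding s_def by (rule S2[OF n(1)])
    finally have "(s / 2)\<^sup>2 * prob (N m - T m r) \<le> K * s"
      using K s by (subst (asm) ennreal_le_iff) auto
    then have "prob (N m - T m r) \<le> 4 * K / s"
      using s by (simp add: field_simps power2_eq_square)
    also have "\<dots> \<le> 4 * K / (2 * real r)" using s K r by (intro divide_left_mono) auto
    finally have **: "prob (N m - T m r) \<le> 2 * (K / real r)" by simp
    have "prob (N m) \<le> prob (T m r \<union> (N m - T m r))"
      using NE TE D by (intro finite_measure_mono) auto
    also have "\<dots> \<le> prob (T m r) + prob (N m - T m r)" by (rule measure_Un_le[OF TE D])
    finally show ?thesis using ** by linarith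
  qed
  have null: "N m \<in> null_sets M" for m
  proof -
    have "\<omega> \<notin> T m (Suc (W m \<omega>))" for \<omega> by (simp add: T_def)
    then have "(\<Inter>r. T m r) = {}" by blast
    moreover have "(\<lambda>r. prob (T m r)) \<longlonglongrightarrow> prob (\<Inter>r. T m r)"
      by (rule finite_Lim_measure_decseq) (use TE in \<open>auto simp: T_def decseq_def\<close>)
    ultimately have "(\<lambda>r. prob (T m r)) \<longlonglongrightarrow> 0" by simp
    moreover have "(\<lambda>r. 2 * (K / real r)) \<longlonglongrightarrow> 0"
      by (rule tendsto_mult_right_zero[OF lim_const_over_n])
    ultimately have "(\<lambda>r. prob (T m r) + 2 * (K / real r)) \<longlonglongrightarrow> 0 + 0"
      by (rule tendsto_add)
    then have "prob (N m) \<le> 0 + 0"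
      by (rule LIMSEQ_le_const) (use bound in blast)
    then show ?thesis using NE by (simp add: null_sets_def emeasure_eq_measure measure_le_0_iff)
  qed
  have "AE \<omega> in M. \<forall>m. \<omega> \<notin> N m" by (simp add: AE_all_countable AE_not_in null)
  moreover have "AE \<omega> in M. \<omega> \<in> space M" by simp
  ultimately show ?thesis
  proof eventually_elim
    fix \<omega> assume "\<forall>m. \<omega> \<notin> N m" "\<omega> \<in> space M"
    then show "\<exists>\<^sub>\<infinity>j. W j \<omega> = 0 \<and> eps (int (Suc j)) \<omega> > t j"
      by (auto simp: INFM_nat_le N_def A_def)
  qed
qed

end

section \<open>Block sums of a Gaussian stationary sequence\<close>

text \<open>The degenerate case is covered by \<open>\<sigma> = 0\<close>.\<close>

lemma (in prob_space) centred_gaussian_even_moments: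
  assumes X: "gaussian_rv M X" and int: "integrable M X" and zero: "expectation X = 0"
  shows "\<exists>\<sigma>\<ge>0. \<forall>k. has_bochner_integral M (\<lambda>\<omega>. X \<omega> ^ (2 * k))
    (fact (2 * k) / (2 ^ k * fact k) * \<sigma> ^ (2 * k))"
proof -
  have [measurable]: "X \<in> borel_measurable M" using int by simp
  consider (const) m where "AE \<omega> in M. X \<omega> = m"
    | (density) m \<sigma> where "\<sigma> > 0" "distributed M lborel X (\<lambda>x. ennreal (normal_density m \<sigma> x))"
    using X by (auto simp: gaussian_rv_def)
  then show ?thesis
  proof cases
    case const
    have "expectation X = expectation (\<lambda>_. m)"
      by (rule integral_cong_AE) (use const in auto)
    then have "m = 0" using zero by (simp add: prob_space)
    then have AE: "AE \<omega> in M. X \<omega> = 0" using const by simp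
    have "has_bochner_integral M (\<lambda>\<omega>. X \<omega> ^ (2 * k)) (fact (2 * k) / (2 ^ k * fact k) * 0 ^ (2 * k))" for k
    proof -
      have "has_bochner_integral M (\<lambda>\<omega>. 0 ^ (2 * k) :: real) (0 ^ (2 * k))"
        using has_bochner_integral_integrable[of M "\<lambda>\<omega>. 0 ^ (2 * k) :: real"] by (simp add: prob_space)
      then have "has_bochner_integral M (\<lambda>\<omega>. X \<omega> ^ (2 * k)) (0 ^ (2 * k))"
        by (rule has_bochner_integral_cong_AE[THEN iffD1, rotated 3]) (use AE in auto)
      then show ?thesis by (cases "k = 0") (auto simp: power_0_left)
    qed
    then show ?thesis by (intro exI[of _ 0]) auto
  next
    case density
    have "expectation X = m" by (rule normal_distributed_expectation[OF density])
    then have m: "m = 0" using zero by simp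
    note d = density(2)[unfolded m]
    have "has_bochner_integral M (\<lambda>\<omega>. X \<omega> ^ (2 * k)) (fact (2 * k) / (2 ^ k * fact k) * \<sigma> ^ (2 * k))" for k
    proof -
      have h: "has_bochner_integral lborel (\<lambda>x. normal_density 0 \<sigma> x * x ^ (2 * k))
          (fact (2 * k) / ((2 / \<sigma>\<^sup>2) ^ k * fact k))"
        using normal_moment_even[OF density(1), of 0 k] by simp
      then have "integrable M (\<lambda>\<omega>. X \<omega> ^ (2 * k))"
        using distributed_integrable[OF d, of "\<lambda>x. x ^ (2 * k)"]
        by (auto simp: has_bochner_integral_iff)
      moreover have "expectation (\<lambda>\<omega>. X \<omega> ^ (2 * k)) = fact (2 * k) / ((2 / \<sigma>\<^sup>2) ^ k * fact k)"
        using distributed_integral[OF d, of "\<lambda>x. x ^ (2 * k)"] h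
        by (auto simp: has_bochner_integral_iff)
      moreover have "fact (2 * k) / ((2 / \<sigma>\<^sup>2) ^ k * fact k) = fact (2 * k) / (2 ^ k * fact k) * \<sigma> ^ (2 * k)"
        by (simp add: power_divide power_mult)
      ultimately show ?thesis by (simp add: has_bochner_integral_iff)
    qed
    then show ?thesis using density(1) by (intro exI[of _ \<sigma>]) auto
  qed
qed

text \<open>A stationary centred Gaussian sequence whose series of covariances converges.\<close>

locale gaussian_noise = prob_space M for M :: "'a measure" +
  fixes g :: "int \<Rightarrow> 'a \<Rightarrow> real"
  assumes stationary: "stationary_sequence M g" and gaussian: "gaussian_sequence M g"
    and centred: "centered_sequence M g"
    and cov_summable: "summable (\<lambda>k. covariance M (g 0) (g (int k)))"
begin

lemma integrable_g: "integrable M (g k)" and expectation_g: "expectation (g k) = 0"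
  using centred by (auto simp: centered_sequence_def)

lemma measurable_g [measurable]: "g k \<in> borel_measurable M"
  using integrable_g by simp

lemma gaussian_block: "gaussian_rv M (\<lambda>\<omega>. \<Sum>k\<in>J. g k \<omega>)" if "finite J"
proof -
  have "gaussian_rv M (\<lambda>\<omega>. \<Sum>k\<in>J. 1 * g k \<omega>)"
    using gaussian that unfolding gaussian_sequence_def by (elim allE[of _ J] allE[of _ "\<lambda>_. 1"] impE)
  then show ?thesis by simp
qed

lemma block_moments:
  assumes "finite J"
  shows "\<exists>\<sigma>\<ge>0. \<forall>k. has_bochner_integral M (\<lambda>\<omega>. (\<Sum>i\<in>J. g i \<omega>) ^ (2 * k))
    (fact (2 * k) / (2 ^ k * fact k) * \<sigma> ^ (2 * k))"
  using assms
  by (intro centred_gaussian_even_moments gaussian_block)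
     (auto simp: integrable_g expectation_g)

lemma integrable_product: "integrable M (\<lambda>\<omega>. g i \<omega> * g j \<omega>)"
proof -
  have sq: "integrable M (\<lambda>\<omega>. (g k \<omega>)\<^sup>2)" for k
  proof -
    obtain \<sigma> where "\<And>r. has_bochner_integral M (\<lambda>\<omega>. (\<Sum>i\<in>{k}. g i \<omega>) ^ (2 * r))
      (fact (2 * r) / (2 ^ r * fact r) * \<sigma> ^ (2 * r))" using block_moments[of "{k}"] by auto
    from this[of 1] show ?thesis by (simp add: has_bochner_integral_iff)
  qed
  show ?thesis
  proof (rule Bochner_Integration.integrable_bound)
    show "integrable M (\<lambda>\<omega>. (g i \<omega>)\<^sup>2 + (g j \<omega>)\<^sup>2)" using sq by simp
    have "\<bar>a * b\<bar> \<le> \<bar>a\<^sup>2 + b\<^sup>2\<bar>" for a b :: real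
    proof -
      have "2 * \<bar>a\<bar> * \<bar>b\<bar> \<le> a\<^sup>2 + b\<^sup>2" using sum_squares_bound[of "\<bar>a\<bar>" "\<bar>b\<bar>"] by simp
      moreover have "0 \<le> \<bar>a\<bar> * \<bar>b\<bar>" by simp
      ultimately show ?thesis unfolding abs_mult by linarith
    qed
    then show "AE \<omega> in M. norm (g i \<omega> * g j \<omega>) \<le> norm ((g i \<omega>)\<^sup>2 + (g j \<omega>)\<^sup>2)" by simp
  qed measurable
qed

lemma expectation_product_shift: "expectation (\<lambda>\<omega>. g (i + h) \<omega> * g (j + h) \<omega>) = expectation (\<lambda>\<omega>. g i \<omega> * g j \<omega>)"
proof -
  let ?P = "Pi\<^sub>M UNIV (\<lambda>_. borel) :: (int \<Rightarrow> real) measure"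
  let ?f = "\<lambda>x :: int \<Rightarrow> real. x i * x j"
  have f: "?f \<in> borel_measurable ?P" by measurable
  have m: "(\<lambda>\<omega> k. g (k + h) \<omega>) \<in> measurable M ?P" for h
    by (rule measurable_PiM_single') (auto simp: space_PiM)
  have "expectation (\<lambda>\<omega>. g (i + h) \<omega> * g (j + h) \<omega>) = (\<integral>x. ?f x \<partial>distr M ?P (\<lambda>\<omega> k. g (k + h) \<omega>))"
    using integral_distr[OF m f, of h] by simp
  also have "\<dots> = (\<integral>x. ?f x \<partial>distr M ?P (\<lambda>\<omega> k. g k \<omega>))"
    using stationary by (simp add: stationary_sequence_def)
  also have "\<dots> = expectation (\<lambda>\<omega>. g i \<omega> * g j \<omega>)"
    using integral_distr[OF m f, of 0] by simp
  finally show ?thesis .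
qed

text \<open>Adding one term to a block increases the second moment by \<open>2 * (c 0 + ... + c l) - c 0\<close>, where \<open>c\<close> is
the covariance function. These partial sums are bounded because the series converges; absolute
convergence is not needed.\<close>

lemma block_second_moment_bound:
  obtains C where "C \<ge> 0" "\<And>a l. expectation (\<lambda>\<omega>. (\<Sum>i = 1..l. g (int (a + i)) \<omega>)\<^sup>2) \<le> C * real l"
proof -
  define c where "c k = expectation (\<lambda>\<omega>. g 0 \<omega> * g (int k) \<omega>)" for k
  have "summable c" using cov_summable by (simp add: c_def[abs_def] covariance_def expectation_g)
  then have "Bseq (\<lambda>n. \<Sum>k<n. c k)"
    by (simp add: summable_iff_convergent convergent_imp_Bseq)
  then obtain B where B: "B > 0" "\<And>n. \<bar>\<Sum>k<n. c k\<bar> \<le> B" by (auto simp: Bseq_def)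
  define C where "C = 2 * B + \<bar>c 0\<bar>"
  show ?thesis
  proof (rule that[of C])
    show "C \<ge> 0" using B by (simp add: C_def)
    fix a l
    show "expectation (\<lambda>\<omega>. (\<Sum>i = 1..l. g (int (a + i)) \<omega>)\<^sup>2) \<le> C * real l"
    proof (induction l)
      case (Suc l)
      let ?S = "\<lambda>l \<omega>. \<Sum>i = 1..l. g (int (a + i)) \<omega>"
      let ?x = "g (int (a + Suc l))"
      have int1: "integrable M (\<lambda>\<omega>. (?S l \<omega>)\<^sup>2)"
        unfolding power2_eq_square sum_product by (intro Bochner_Integration.integrable_sum integrable_product)
      have int2: "integrable M (\<lambda>\<omega>. \<Sum>i = 1..l. g (int (a + i)) \<omega> * ?x \<omega>)"
        by (intro Bochner_Integration.integrable_sum integrable_product)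
      have "expectation (\<lambda>\<omega>. (?S (Suc l) \<omega>)\<^sup>2) =
        expectation (\<lambda>\<omega>. (?S l \<omega>)\<^sup>2 + 2 * (\<Sum>i = 1..l. g (int (a + i)) \<omega> * ?x \<omega>) + ?x \<omega> * ?x \<omega>)"
        by (rule Bochner_Integration.integral_cong)
           (simp_all add: power2_sum power2_eq_square sum_distrib_right[symmetric] algebra_simps)
      also have "\<dots> = expectation (\<lambda>\<omega>. (?S l \<omega>)\<^sup>2) + 2 * expectation (\<lambda>\<omega>. \<Sum>i = 1..l. g (int (a + i)) \<omega> * ?x \<omega>)
          + expectation (\<lambda>\<omega>. ?x \<omega> * ?x \<omega>)"
        using int1 int2 integrable_product by simp
      also have "expectation (\<lambda>\<omega>. ?x \<omega> * ?x \<omega>) = c 0"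
        using expectation_product_shift[of 0 "int (a + Suc l)" 0] by (simp add: c_def)
      also have "expectation (\<lambda>\<omega>. \<Sum>i = 1..l. g (int (a + i)) \<omega> * ?x \<omega>) = (\<Sum>i = 1..l. c (Suc l - i))"
      proof (subst Bochner_Integration.integral_sum)
        show "(\<Sum>i = 1..l. expectation (\<lambda>\<omega>. g (int (a + i)) \<omega> * ?x \<omega>)) = (\<Sum>i = 1..l. c (Suc l - i))"
        proof (rule sum.cong[OF refl])
          fix i assume "i \<in> {1..l}"
          then have "int (Suc l - i) + int (a + i) = int (a + Suc l)" by auto
          then show "expectation (\<lambda>\<omega>. g (int (a + i)) \<omega> * ?x \<omega>) = c (Suc l - i)"
            using expectation_product_shift[of 0 "int (a + i)" "int (Suc l - i)"] unfolding c_def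
            by (simp only: add_0)
        qed
      qed (rule integrable_product)
      also have "(\<Sum>i = 1..l. c (Suc l - i)) = (\<Sum>i = 1..l. c i)"
        by (rule sum.reindex_bij_witness[where i = "\<lambda>i. Suc l - i" and j = "\<lambda>i. Suc l - i"]) auto
      also have "(\<Sum>i = 1..l. c i) = (\<Sum>i<Suc l. c i) - c 0"
        by (induction l) simp_all
      finally have "expectation (\<lambda>\<omega>. (?S (Suc l) \<omega>)\<^sup>2) = expectation (\<lambda>\<omega>. (?S l \<omega>)\<^sup>2) + 2 * (\<Sum>i<Suc l. c i) - c 0"
        by simp
      also have "\<dots> \<le> C * real l + C"
        using Suc B(2)[of "Suc l"] unfolding C_def by linarith
      finally show ?case by (simp add: algebra_simps)
    qed simp
  qed
qed

text \<open>The moment of order \<open>2 * r\<close> of a block sum of length \<open>l\<close> is of order \<open>l ^ r\<close>, so by the Markov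
inequality the block sum exceeds \<open>\<eta> * l\<close> with probability of order \<open>1 / l ^ r\<close>.\<close>

lemma blocks_eventually_small:
  fixes a l :: "nat \<Rightarrow> nat"
  assumes l: "\<And>k. l k \<ge> 1" and sm: "summable (\<lambda>k. 1 / real (l k) ^ r)" and \<eta>: "\<eta> > 0"
  shows "AE \<omega> in M. \<forall>\<^sub>F k in sequentially. \<bar>\<Sum>i = 1..l k. g (int (a k + i)) \<omega>\<bar> \<le> \<eta> * real (l k)"
proof -
  obtain C where C: "C \<ge> 0" "\<And>a l. expectation (\<lambda>\<omega>. (\<Sum>i = 1..l. g (int (a + i)) \<omega>)\<^sup>2) \<le> C * real l"
    using block_second_moment_bound by metis
  define S where "S k \<omega> = (\<Sum>i = 1..l k. g (int (a k + i)) \<omega>)" for k \<omega>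
  have [measurable]: "S k \<in> borel_measurable M" for k unfolding S_def[abs_def] by measurable
  define A where "A k = {\<omega> \<in> space M. \<eta> * real (l k) < \<bar>S k \<omega>\<bar>}" for k
  have A [measurable]: "A k \<in> events" for k unfolding A_def by measurable
  define D where "D = fact (2 * r) / (2 ^ r * fact r) * (C / \<eta>\<^sup>2) ^ r"
  have bound: "prob (A k) \<le> D * (1 / real (l k) ^ r)" for k
  proof -
    let ?J = "(\<lambda>i. int (a k + i)) ` {1..l k}"
    have S_eq: "S k \<omega> = (\<Sum>i\<in>?J. g i \<omega>)" for \<omega>
      unfolding S_def by (subst sum.reindex) (auto simp: inj_on_def)
    obtain \<sigma> where \<sigma>: "\<And>r. has_bochner_integral M (\<lambda>\<omega>. S k \<omega> ^ (2 * r))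
      (fact (2 * r) / (2 ^ r * fact r) * \<sigma> ^ (2 * r))" using block_moments[of ?J] unfolding S_eq by auto
    have "\<sigma>\<^sup>2 \<le> C * real (l k)"
      using \<sigma>[of 1] C(2)[of "a k" "l k"] by (simp add: has_bochner_integral_iff S_def)
    then have "(\<sigma>\<^sup>2) ^ r \<le> (C * real (l k)) ^ r" by (intro power_mono) auto
    then have "fact (2 * r) / (2 ^ r * fact r) * (\<sigma>\<^sup>2) ^ r \<le> fact (2 * r) / (2 ^ r * fact r) * (C * real (l k)) ^ r"
      by (intro mult_left_mono) auto
    then have m: "expectation (\<lambda>\<omega>. S k \<omega> ^ (2 * r)) \<le> fact (2 * r) / (2 ^ r * fact r) * (C * real (l k)) ^ r"
      using has_bochner_integral_integral_eq[OF \<sigma>[of r]] by (simp only: power_mult)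
    have "(\<eta> * real (l k)) ^ (2 * r) * prob (A k) = expectation (\<lambda>\<omega>. (\<eta> * real (l k)) ^ (2 * r) * indicator (A k) \<omega>)"
      by simp
    also have "\<dots> \<le> expectation (\<lambda>\<omega>. S k \<omega> ^ (2 * r))"
    proof (rule integral_mono)
      show "integrable M (\<lambda>\<omega>. S k \<omega> ^ (2 * r))" using \<sigma>[of r] by (simp add: has_bochner_integral_iff)
      show "integrable M (\<lambda>\<omega>. (\<eta> * real (l k)) ^ (2 * r) * indicator (A k) \<omega>)"
        by (intro integrable_mult_right integrable_real_indicator) (auto simp: emeasure_eq_measure)
      fix \<omega>
      have "(\<eta> * real (l k)) ^ (2 * r) \<le> \<bar>S k \<omega>\<bar> ^ (2 * r)" if "\<omega> \<in> A k"
        using that \<eta> by (intro power_mono) (auto simp: A_def)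
      then show "(\<eta> * real (l k)) ^ (2 * r) * indicator (A k) \<omega> \<le> S k \<omega> ^ (2 * r)"
        by (auto simp: indicator_def power_even_abs)
    qed
    also note m
    finally have "prob (A k) \<le> fact (2 * r) / (2 ^ r * fact r) * (C * real (l k)) ^ r / (\<eta> * real (l k)) ^ (2 * r)"
      using \<eta> l[of k] by (simp add: field_simps)
    also have "\<dots> = D * (1 / real (l k) ^ r)"
      using \<eta> l[of k] unfolding D_def
      by (simp add: power_mult power_mult_distrib power_divide power2_eq_square field_simps)
    finally show ?thesis .
  qed
  have "summable (\<lambda>k. prob (A k))"
    by (rule summable_comparison_test'[OF summable_mult[OF sm, of D]]) (use bound in auto)
  then have "AE \<omega> in M. \<forall>\<^sub>F k in sequentially. \<omega> \<in> space M - A k"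
    by (intro borel_cantelli_AE1) (auto simp: emeasure_eq_measure)
  then show ?thesis
    by eventually_elim (auto elim!: eventually_mono simp: A_def S_def not_less)
qed

end

section \<open>The approximation error\<close>

lemma chain_excursion:
  assumes "chain V eps j \<omega> = 0" "t < eps (int (Suc j)) \<omega>" "1 \<le> i" "i \<le> t"
  shows "chain V eps (j + i) \<omega> = eps (int (Suc j)) \<omega> - i"
  using assms(3,4)
proof (induction i rule: dec_induct)
  case base
  then show ?case using assms(1,2) by simp
next
  case (step i)
  then show ?case using assms(2) by simp
qed

lemma limsup_ereal_ge:
  fixes f :: "nat \<Rightarrow> real"
  assumes "\<exists>\<^sub>\<infinity>n. c \<le> f n"
  shows "ereal c \<le> limsup (\<lambda>n. ereal (f n))"
proof (rule ccontr)
  assume "\<not> ?thesis"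
  then have "\<forall>\<^sub>F n in sequentially. ereal (f n) < ereal c"
    by (intro Limsup_lessD) simp
  then have "\<forall>\<^sub>\<infinity>n. \<not> c \<le> f n"
    by (simp add: cofinite_eq_sequentially not_le)
  then show False using assms by (simp add: frequently_def)
qed

text \<open>The normalisation \<open>(n * ln n) powr (1 / p)\<close> at \<open>n = j + 3\<close>; the shift makes the logarithm at least 1.\<close>

definition jump_scale :: "real \<Rightarrow> nat \<Rightarrow> real" where
  "jump_scale p j = (real (j + 3) * ln (real (j + 3))) powr (1 / p)"

lemma ln_ge_1: "x \<ge> 3 \<Longrightarrow> ln x \<ge> (1 :: real)"
  using exp_le by (subst ln_ge_iff) auto

lemma jump_scale_bounds:
  assumes p: "p > 2"
  shows "real (j + 3) powr (1 / p) \<le> jump_scale p j" "1 \<le> jump_scale p j"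
    "jump_scale p j \<le> real (j + 3)"
proof -
  define m where "m = real (j + 3)"
  have m: "m \<ge> 3" "ln m \<ge> 1" using ln_ge_1[of m] by (auto simp: m_def)
  have "m * 1 \<le> m * ln m" using m by (intro mult_left_mono) auto
  then show *: "real (j + 3) powr (1 / p) \<le> jump_scale p j"
    unfolding jump_scale_def m_def[symmetric] using p m by (intro powr_mono2) auto
  have "1 \<le> m powr (1 / p)" using p m by (intro ge_one_powr_ge_zero) auto
  then show "1 \<le> jump_scale p j" using * by (simp add: m_def)
  have "m * ln m \<le> m * m" using m ln_le_minus_one[of m] by (intro mult_left_mono) auto
  also have "\<dots> = m powr 2" using m by (simp add: power2_eq_square)
  also have "\<dots> \<le> m powr p" using p m by (intro powr_mono) auto
  finally have "(m * ln m) powr (1 / p) \<le> (m powr p) powr (1 / p)"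
    using m p by (intro powr_mono2) auto
  then show "jump_scale p j \<le> real (j + 3)"
    unfolding jump_scale_def m_def[symmetric] using p m by (simp add: powr_powr)
qed

lemma jump_scale_mono:
  assumes p: "p > 2" shows "mono (jump_scale p)"
proof (rule monoI)
  fix i j :: nat assume "i \<le> j"
  then show "jump_scale p i \<le> jump_scale p j"
    unfolding jump_scale_def using p by (intro powr_mono2 mult_mono) auto
qed

lemma normalization_lower:
  assumes p: "p > 2" and n: "2 \<le> n" "n \<le> 2 * (j + 3)"
  shows "1 / (2 * jump_scale p j) \<le> (real n * ln (real n)) powr - (1 / p)"
proof -
  define m where "m = real (j + 3)"
  have m: "m \<ge> 3" "ln m \<ge> 1" using ln_ge_1[of m] by (auto simp: m_def)
  have nm: "real n \<le> 2 * m" using n by (simp add: m_def)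
  have pos: "0 < real n * ln (real n)" using n by simp
  have "ln (real n) \<le> ln (2 * m)" using nm n by (subst ln_le_cancel_iff) auto
  also have "\<dots> = ln 2 + ln m" using m by (simp add: ln_mult)
  also have "\<dots> \<le> 2 * ln m" using m by simp
  finally have "real n * ln (real n) \<le> (2 * m) * (2 * ln m)"
    using nm n m by (intro mult_mono) auto
  then have "(real n * ln (real n)) powr (1 / p) \<le> (4 * (m * ln m)) powr (1 / p)"
    using pos p by (intro powr_mono2) auto
  also have "\<dots> = 4 powr (1 / p) * jump_scale p j"
    using m by (simp add: jump_scale_def powr_mult m_def)
  also have "\<dots> \<le> 4 powr (1 / 2) * jump_scale p j"
    using p jump_scale_bounds(2)[OF p, of j] by (intro mult_right_mono powr_mono) (auto simp: field_simps)
  also have "\<dots> = 2 * jump_scale p j" by (simp add: powr_half_sqrt)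
  finally have upper: "(real n * ln (real n)) powr (1 / p) \<le> 2 * jump_scale p j" .
  have "0 < (real n * ln (real n)) powr (1 / p)"
    using pos unfolding powr_gt_zero by (metis less_irrefl)
  then have "1 / (2 * jump_scale p j) \<le> 1 / (real n * ln (real n)) powr (1 / p)"
    using upper by (rule frac_le[OF zero_le_one order_refl])
  then show ?thesis by (simp add: powr_minus_divide)
qed

text \<open>A chain and a Gaussian sequence on the same probability space; nothing relates the two.\<close>

locale chain_with_noise = started_chain M p eps V + gaussian_noise M g
  for M :: "'a measure" and p eps V g
begin

text \<open>The length, in time steps, of the excursions away from zero that are looked for.\<close>

definition jump_length :: "nat \<Rightarrow> nat" where
  "jump_length j = nat \<lfloor>jump_scale p j\<rfloor>"

lemma jump_length_bounds:
  "1 \<le> jump_length j" "real (jump_length j) \<le> jump_scale p j" "jump_scale p j \<le> 2 * real (jump_length j)"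
proof -
  have f: "1 \<le> \<lfloor>jump_scale p j\<rfloor>"
    using jump_scale_bounds(2)[OF p_gt_2, of j] by simp
  then have "real (jump_length j) = of_int \<lfloor>jump_scale p j\<rfloor>" by (simp add: jump_length_def)
  with f show "1 \<le> jump_length j" "real (jump_length j) \<le> jump_scale p j"
    "jump_scale p j \<le> 2 * real (jump_length j)" by linarith+
qed

lemma jump_tails_not_summable: "\<not> summable (\<lambda>j. prob {\<omega> \<in> space M. eps 1 \<omega> > jump_length j})"
proof
  assume *: "summable (\<lambda>j. prob {\<omega> \<in> space M. eps 1 \<omega> > jump_length j})"
  define b where "b n = 1 / (real n * (1 + ln (real n)) powr 1)" for n
  have "summable (\<lambda>j. tail_const * b (j + 3))"
  proof (rule summable_comparison_test'[OF *, of 0])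
    fix j :: nat
    define m where "m = real (j + 3)"
    have m: "m \<ge> 3" "ln m \<ge> 1" using ln_ge_1[of m] by (auto simp: m_def)
    have "b (j + 3) \<le> 1 / (m * ln m)"
      unfolding b_def m_def[symmetric] using m by (intro divide_left_mono) auto
    also have "\<dots> = jump_scale p j powr - p"
      unfolding jump_scale_def m_def[symmetric] using m p_gt_2 by (simp add: powr_powr powr_minus_divide)
    also have "\<dots> \<le> real (jump_length j) powr - p"
      using jump_length_bounds[of j] p_gt_2 by (intro powr_mono2') auto
    finally have "tail_const * b (j + 3) \<le> tail_const * real (jump_length j) powr - p"
      using tail_const_pos by (intro mult_left_mono) auto
    also have "\<dots> \<le> prob {\<omega> \<in> space M. eps 1 \<omega> > jump_length j}"
      unfolding prob_eps_tail by (rule zeta_weight_tail_lower[OF jump_length_bounds(1)])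
    finally show "norm (tail_const * b (j + 3)) \<le> prob {\<omega> \<in> space M. eps 1 \<omega> > jump_length j}"
      using tail_const_pos m by (simp add: b_def m_def)
  qed
  then have "summable (\<lambda>j. b (j + 3))"
    using tail_const_pos by (subst (asm) summable_cmult_iff) auto
  then have "summable b" by (subst (asm) summable_iff_shift)
  then show False unfolding b_def using summable_bertrand_iff[of 1] by simp
qed

lemma jump_lengths_summable: "\<exists>r. summable (\<lambda>j. 1 / real (jump_length j) ^ r)"
proof -
  \<comment> \<open>The exponent \<open>r / p \<ge> 2\<close> makes the series of \<open>j powr - (r / p)\<close> converge.\<close>
  define r where "r = nat \<lceil>2 * p\<rceil>"
  have r: "real r \<ge> 2 * p" unfolding r_def by linarith
  have "summable (\<lambda>j. 2 ^ r * real (3 + j) powr - 2)"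
    by (intro summable_mult summable_shifted_powr) simp
  then have "summable (\<lambda>j. 1 / real (jump_length j) ^ r)"
  proof (rule summable_comparison_test'[where N = 0])
    fix j :: nat
    have "real (j + 3) powr 2 \<le> real (j + 3) powr (1 / p * real r)"
      using r p_gt_2 by (intro powr_mono) (auto simp: field_simps)
    also have "\<dots> = (real (j + 3) powr (1 / p)) ^ r"
      by (subst powr_realpow[symmetric]) (simp_all add: powr_powr)
    also have "\<dots> \<le> (2 * real (jump_length j)) ^ r"
      using jump_scale_bounds(1)[OF p_gt_2, of j] jump_length_bounds(3)[of j]
      by (intro power_mono) auto
    finally have *: "real (j + 3) powr 2 \<le> 2 ^ r * real (jump_length j) ^ r"
      by (simp add: power_mult_distrib)
    have "1 / real (jump_length j) ^ r = 2 ^ r / (2 ^ r * real (jump_length j) ^ r)" by simp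
    also have "\<dots> \<le> 2 ^ r / real (j + 3) powr 2"
      using * jump_length_bounds(1)[of j] by (intro divide_left_mono) auto
    finally show "norm (1 / real (jump_length j) ^ r) \<le> 2 ^ r * real (3 + j) powr - 2"
      by (simp add: powr_minus_divide add_ac)
  qed
  then show ?thesis ..
qed

text \<open>After a jump above \<open>t\<close> made from zero at time \<open>j\<close>, the chain stays away from zero for \<open>t\<close> steps. Over
this block the counting sum changes by \<open>- nu 0 * t\<close>, while the Gaussian sum changes by at most half of
that in absolute value. So the error is at least \<open>nu 0 * t / 4\<close> at one of the two ends of the block.\<close>

lemma approximation_error_limsup:
  "AE \<omega> in M. limsup (\<lambda>n. ereal ((real n * ln (real n)) powr - (1 / p) *
     \<bar>(\<Sum>k=1..n. (of_bool (W k \<omega> = 0) - nu 0)) - (\<Sum>k=1..n. g (int k) \<omega>)\<bar>)) > 0"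
proof -
  have nu0: "nu 0 > 0" using mu_ge_1 by (simp add: nu_0)
  obtain r where r: "summable (\<lambda>j. 1 / real (jump_length j) ^ r)"
    using jump_lengths_summable by blast
  have jumps: "AE \<omega> in M. \<exists>\<^sub>\<infinity>j. W j \<omega> = 0 \<and> eps (int (Suc j)) \<omega> > jump_length j"
  proof (rule long_jumps_from_zero_infinitely_often[OF _ jump_tails_not_summable])
    show "mono jump_length"
      using jump_scale_mono[OF p_gt_2] unfolding mono_def jump_length_def by (auto intro!: nat_mono floor_mono)
  qed
  have blocks: "AE \<omega> in M. \<forall>\<^sub>F j in sequentially.
      \<bar>\<Sum>i = 1..jump_length j. g (int (j + i)) \<omega>\<bar> \<le> nu 0 / 2 * real (jump_length j)"
    using nu0 by (intro blocks_eventually_small[OF jump_length_bounds(1) r, of "nu 0 / 2" "\<lambda>j. j"]) simp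
  show ?thesis
    using jumps blocks
  proof eventually_elim
    fix \<omega>
    assume j_inf: "\<exists>\<^sub>\<infinity>j. W j \<omega> = 0 \<and> eps (int (Suc j)) \<omega> > jump_length j"
      and small: "\<forall>\<^sub>F j in sequentially.
        \<bar>\<Sum>i = 1..jump_length j. g (int (j + i)) \<omega>\<bar> \<le> nu 0 / 2 * real (jump_length j)"
    define D where "D n = (\<Sum>k=1..n. (of_bool (W k \<omega> = 0) - nu 0)) - (\<Sum>k=1..n. g (int k) \<omega>)" for n
    define f where "f n = (real n * ln (real n)) powr - (1 / p) * \<bar>D n\<bar>" for n
    have "\<exists>n\<ge>N. nu 0 / 16 \<le> f n" for N
    proof -
      obtain J where J: "\<And>j. j \<ge> J \<Longrightarrow>
          \<bar>\<Sum>i = 1..jump_length j. g (int (j + i)) \<omega>\<bar> \<le> nu 0 / 2 * real (jump_length j)"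
        using small by (auto simp: eventually_sequentially)
      obtain j where j: "j \<ge> max J (max N 2)" "W j \<omega> = 0" "eps (int (Suc j)) \<omega> > jump_length j"
        using j_inf unfolding INFM_nat_le by blast
      define t where "t = jump_length j"
      have shift: "(\<Sum>k = 1..j + t. h k) - (\<Sum>k = 1..j. h k) = (\<Sum>i = 1..t. h (j + i))" for h :: "nat \<Rightarrow> real"
        by (induction t) simp_all
      have "(\<Sum>i = 1..t. (of_bool (W (j + i) \<omega> = 0) - nu 0)) = (\<Sum>i = 1..t. - nu 0)"
      proof (rule sum.cong[OF refl])
        fix i assume i: "i \<in> {1..t}"
        then have "W (j + i) \<omega> = eps (int (Suc j)) \<omega> - i"
          using j by (intro chain_excursion[of _ _ _ _ t]) (auto simp: t_def)
        then have "W (j + i) \<omega> \<noteq> 0" using i j(3) by (auto simp: t_def)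
        then show "of_bool (W (j + i) \<omega> = 0) - nu 0 = - nu 0" by simp
      qed
      also have "\<dots> = - (nu 0 * real t)" by simp
      finally have "D (j + t) - D j = - (nu 0 * real t) - (\<Sum>i = 1..t. g (int (j + i)) \<omega>)"
        using shift[of "\<lambda>k. of_bool (W k \<omega> = 0) - nu 0"] shift[of "\<lambda>k. g (int k) \<omega>"]
        unfolding D_def by linarith
      moreover have "\<bar>\<Sum>i = 1..t. g (int (j + i)) \<omega>\<bar> \<le> nu 0 * real t / 2"
        using J[of j] j(1) by (simp add: t_def)
      ultimately have "nu 0 * real t / 4 \<le> \<bar>D (j + t)\<bar> \<or> nu 0 * real t / 4 \<le> \<bar>D j\<bar>"
        by linarith
      then obtain n where n: "n = j \<or> n = j + t" "nu 0 * real t / 4 \<le> \<bar>D n\<bar>" by blast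
      have "real t \<le> real (j + 3)"
        using jump_length_bounds(2)[of j] jump_scale_bounds(3)[OF p_gt_2, of j] unfolding t_def by linarith
      then have n2: "2 \<le> n" "n \<le> 2 * (j + 3)" "N \<le> n" using n(1) j(1) by auto
      have pos: "jump_scale p j > 0" using jump_scale_bounds(2)[OF p_gt_2, of j] by simp
      have "nu 0 / 16 = 1 / (2 * jump_scale p j) * (nu 0 * (jump_scale p j / 2) / 4)"
        using pos by (simp add: field_simps)
      also have "\<dots> \<le> 1 / (2 * jump_scale p j) * (nu 0 * real t / 4)"
        using pos nu0 jump_length_bounds(3)[of j]
        by (intro mult_left_mono divide_right_mono) (auto simp: t_def)
      also have "\<dots> \<le> f n"
        unfolding f_def using n(2) nu0 normalization_lower[OF p_gt_2 n2(1,2)] by (intro mult_mono) auto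
      finally show ?thesis using n2(3) by blast
    qed
    then have "ereal (nu 0 / 16) \<le> limsup (\<lambda>n. ereal (f n))"
      by (intro limsup_ereal_ge) (auto simp: INFM_nat_le)
    moreover have "0 < ereal (nu 0 / 16)" using nu0 by simp
    ultimately show "limsup (\<lambda>n. ereal ((real n * ln (real n)) powr - (1 / p) *
        \<bar>(\<Sum>k=1..n. (of_bool (W k \<omega> = 0) - nu 0)) - (\<Sum>k=1..n. g (int k) \<omega>)\<bar>)) > 0"
      unfolding f_def D_def by (rule less_le_trans[rotated])
  qed
qed

end

theorem proposition15:
  fixes p :: real and M :: "'a measure" and eps :: "int \<Rightarrow> 'a \<Rightarrow> nat"
  assumes "p > 2"
    and "prob_space M"
    and "iid_innovations M eps (zeta_weight p)"
  shows "(\<forall>V V'. stationary_pair M eps V V' \<longrightarrow>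
            (\<Sum>n. ennreal (real (n + 1) powr (p - 2) *
              measure M {\<omega> \<in> space M. meeting_time (chain V eps) (chain V' eps) \<omega> \<ge> enat (n + 1)})) = \<infinity> \<and>
            (\<forall>e>0. (\<Sum>n. ennreal (real (n + 2) powr (p - 2) * ln (real (n + 2)) powr - (1 + e) *
              measure M {\<omega> \<in> space M. meeting_time (chain V eps) (chain V' eps) \<omega> \<ge> enat (n + 2)})) < \<infinity>)) \<and>
         (\<forall>V g. indep_of_innovations M eps V \<longrightarrow>
            stationary_sequence M g \<longrightarrow> gaussian_sequence M g \<longrightarrow> centered_sequence M g \<longrightarrow>
            summable (\<lambda>k. covariance M (g 0) (g (int k))) \<longrightarrow>
            (AE \<omega> in M. limsup (\<lambda>n. ereal ((real n * ln (real n)) powr - (1 / p) *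
                \<bar>(\<Sum>k=1..n. (of_bool (chain V eps k \<omega> = 0) - stationary_weight M (eps 1) 0)) -
                 (\<Sum>k=1..n. g (int k) \<omega>)\<bar>)) > 0))"
proof (intro conjI allI impI)
  interpret prob_space M by fact
  interpret zeta_innovations M p eps by unfold_locales fact+
  {
    fix V V' assume "stationary_pair M eps V V'"
    then interpret stationary_coupling M p eps V V' by unfold_locales
    show "(\<Sum>n. ennreal (real (n + 1) powr (p - 2) *
        measure M {\<omega> \<in> space M. meeting_time (chain V eps) (chain V' eps) \<omega> \<ge> enat (n + 1)})) = \<infinity>"
      by (rule meeting_series_diverges)
    fix e :: real assume "e > 0"
    then show "(\<Sum>n. ennreal (real (n + 2) powr (p - 2) * ln (real (n + 2)) powr - (1 + e) *
        measure M {\<omega> \<in> space M. meeting_time (chain V eps) (chain V' eps) \<omega> \<ge> enat (n + 2)})) < \<infinity>"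
      by (rule meeting_series_converges)
  next
    fix V g
    assume "indep_of_innovations M eps V" "stationary_sequence M g" "gaussian_sequence M g"
      "centered_sequence M g" "summable (\<lambda>k. covariance M (g 0) (g (int k)))"
    then interpret chain_with_noise M p eps V g by unfold_locales
    show "AE \<omega> in M. limsup (\<lambda>n. ereal ((real n * ln (real n)) powr - (1 / p) *
        \<bar>(\<Sum>k=1..n. (of_bool (chain V eps k \<omega> = 0) - stationary_weight M (eps 1) 0)) -
         (\<Sum>k=1..n. g (int k) \<omega>)\<bar>)) > 0"
      by (rule approximation_error_limsup)
  }
qed

end
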